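(* Let $A\in\mathbb{R}^{n\times n}$ be a nonsingular totally nonnegative matrix given through a factorization $$A=L_{n-1}L_{n-2}\cdots L_1\,D\,U_1U_2\cdots U_{n-1},$$ where $D$ is diagonal with positive diagonal entries and $L_i$ and $U_i$ are unit lower and unit upper bidiagonal matrices, respectively, with the first $i-1$ entries along the subdiagonal of $L_i$ and of $U_i^T$ zero and the rest nonnegative. Let $e=[1,\dots,1]^T\in\mathbb{R}^n$. Then $$\|A\|_\infty=\|L_{n-1}L_{n-2}\cdots L_1DU_1U_2\cdots U_{n-1}e\|_\infty,$$ $$\|A^{-1}\|_\infty=\bigl\|M(U_{n-1})^{-1}\cdots M(U_1)^{-1}D^{-1}M(L_1)^{-1}\cdots M(L_{n-1})^{-1}e\bigr\|_\infty,$$ and evaluating the right-hand sides by bidiagonal matrix--vector products and substitutions gives $\kappa_\infty(A)=\|A\|_\infty\|A^{-1}\|_\infty$ in $O(n^2)$ flops. Moreover, there are absolute constants $c_0,d>0$ such that if $n^2u\le c_0$, then the value $\widehat{c}$ obtained by evaluating $\bigl\|M(U_{n-1})^{-1}\cdots M(U_1)^{-1}D^{-1}M(L_1)^{-1}\cdots M(L_{n-1})^{-1}e\bigr\|_\infty$ by substitutions in floating-point arithmetic with unit roundoff $u$ satisfies $$\frac{\bigl|\widehat{c}-\|A^{-1}\|_\infty\bigr|}{\|A^{-1}\|_\infty}\le d\,n^2u .$$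
   Context: A matrix $A\in\mathbb{R}^{n\times n}$ is totally nonnegative if every minor (determinant of a square submatrix) is nonnegative. The norm $\|\cdot\|_\infty$ is the matrix norm subordinate to the vector $\infty$-norm (maximum absolute row sum). The comparison matrix $M(X)$ of $X=(x_{ij})$ is defined by $(M(X))_{ii}=|x_{ii}|$ and $(M(X))_{ij}=-|x_{ij}|$ for $i\ne j$. A matrix is upper bidiagonal if its only possibly nonzero entries are in positions $(i,i)$ and $(i,i+1)$; lower bidiagonal if its transpose is upper bidiagonal; "unit" means that all diagonal entries equal $1$. A flop is one scalar addition, subtraction, multiplication or division. The standard model of floating-point arithmetic is used: every operation $\mathrm{op}\in\{+,-,\times,/\}$ on floating-point numbers satisfies $\mathrm{fl}(x\,\mathrm{op}\,y)=(x\,\mathrm{op}\,y)(1+\delta)$ with $|\delta|\le u$. *)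

theory Defs
  imports
    Complex_Main
    "HOL-Library.State_Monad"
    "Jordan_Normal_Form.Gauss_Jordan_Elimination"
    "Jordan_Normal_Form.Determinant"
    "Jordan_Normal_Form.DL_Submatrix"
begin

text \<open>
  All matrix and vector indices start at \<open>0\<close>, as in \<^theory>\<open>Jordan_Normal_Form.Matrix\<close>. In
  particular the \<open>k\<close>-th subdiagonal entry (\<open>1 \<le> k < n\<close>) of a matrix \<open>B\<close> is \<open>B $$ (k, k - 1)\<close>.
\<close>

section \<open>Norms, inverses, products\<close>

definition vec_norm_inf :: "real vec \<Rightarrow> real" where
  "vec_norm_inf v = Max ((\<lambda>i. \<bar>v $ i\<bar>) ` {..<dim_vec v})"

definition mat_norm_inf :: "real mat \<Rightarrow> real" where
  "mat_norm_inf A =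
     Sup {vec_norm_inf (A *\<^sub>v x) / vec_norm_inf x | x.
            x \<in> carrier_vec (dim_col A) \<and> x \<noteq> 0\<^sub>v (dim_col A)}"

lemma abs_le_vec_norm_inf: "i < dim_vec v \<Longrightarrow> \<bar>v $ i\<bar> \<le> vec_norm_inf v"
  unfolding vec_norm_inf_def by (intro Max_ge) auto

lemma mat_norm_inf_eq_max_row_sum:
  assumes A: "A \<in> carrier_mat m n" and m: "0 < m" and n: "0 < n"
  shows "mat_norm_inf A = Max ((\<lambda>i. \<Sum>j<n. \<bar>A $$ (i, j)\<bar>) ` {..<m})" (is "_ = ?M")
proof -
  let ?S = "{vec_norm_inf (A *\<^sub>v x) / vec_norm_inf x | x.
               x \<in> carrier_vec (dim_col A) \<and> x \<noteq> 0\<^sub>v (dim_col A)}"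
  have dims: "dim_row A = m" "dim_col A = n" using A by auto
  have ent: "(A *\<^sub>v x) $ i = (\<Sum>j<n. A $$ (i, j) * x $ j)"
    if "x \<in> carrier_vec n" "i < m" for x i
    using that dims
    by (auto simp: mult_mat_vec_def scalar_prod_def atLeast0LessThan intro!: sum.cong)
  have upper: "vec_norm_inf (A *\<^sub>v x) / vec_norm_inf x \<le> ?M"
    if x: "x \<in> carrier_vec n" "x \<noteq> 0\<^sub>v n" for x
  proof -
    obtain k where k: "k < n" "x $ k \<noteq> 0"
      using x by (metis carrier_vecD eq_vecI index_zero_vec)
    have pos: "0 < vec_norm_inf x"
      using abs_le_vec_norm_inf[of k x] k x by auto
    have "\<bar>(A *\<^sub>v x) $ i\<bar> \<le> ?M * vec_norm_inf x" if i: "i < m" for i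
    proof -
      have "\<bar>(A *\<^sub>v x) $ i\<bar> \<le> (\<Sum>j<n. \<bar>A $$ (i, j)\<bar> * \<bar>x $ j\<bar>)"
        unfolding ent[OF x(1) i] by (rule order_trans[OF sum_abs]) (simp add: abs_mult)
      also have "\<dots> \<le> (\<Sum>j<n. \<bar>A $$ (i, j)\<bar> * vec_norm_inf x)"
        using x by (intro sum_mono mult_left_mono abs_le_vec_norm_inf) auto
      also have "\<dots> = (\<Sum>j<n. \<bar>A $$ (i, j)\<bar>) * vec_norm_inf x"
        by (simp add: sum_distrib_right)
      also have "\<dots> \<le> ?M * vec_norm_inf x"
        using i pos by (intro mult_right_mono Max_ge) auto
      finally show ?thesis .
    qed
    then have "vec_norm_inf (A *\<^sub>v x) \<le> ?M * vec_norm_inf x"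
      unfolding vec_norm_inf_def[of "A *\<^sub>v x"] using m dims by (subst Max_le_iff) auto
    with pos show ?thesis by (simp add: divide_le_eq)
  qed
  have "?M \<in> (\<lambda>i. \<Sum>j<n. \<bar>A $$ (i, j)\<bar>) ` {..<m}"
    using m by (intro Max_in) auto
  then obtain i where i: "i < m" "?M = (\<Sum>j<n. \<bar>A $$ (i, j)\<bar>)"
    by (elim imageE) simp
  define x where "x = vec n (\<lambda>j. if A $$ (i, j) < 0 then - 1 else 1 :: real)"
  have x: "x \<in> carrier_vec n" "x \<noteq> 0\<^sub>v n"
    using n by (auto simp: x_def vec_eq_iff)
  have "(\<lambda>j. \<bar>x $ j\<bar>) ` {..<n} = {1}"
    using n by (auto simp: x_def image_def)
  then have norm_x: "vec_norm_inf x = 1"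
    using x by (simp add: vec_norm_inf_def)
  have "?M = (A *\<^sub>v x) $ i"
    unfolding ent[OF x(1) i(1)] i(2) by (auto simp: x_def intro!: sum.cong)
  also have "\<dots> \<le> vec_norm_inf (A *\<^sub>v x)"
    using abs_le_vec_norm_inf[of i "A *\<^sub>v x"] i dims by auto
  finally have "?M \<le> vec_norm_inf (A *\<^sub>v x) / vec_norm_inf x" by (simp add: norm_x)
  with upper[OF x] have "?M = vec_norm_inf (A *\<^sub>v x) / vec_norm_inf x" by linarith
  then have mem: "?M \<in> ?S" using x dims by auto
  have "Sup ?S = ?M"
    using upper dims by (intro cSup_eq_maximum[OF mem]) auto
  then show ?thesis by (simp add: mat_norm_inf_def)
qed

text \<open>Unspecified if the argument is singular, since \<^const>\<open>mat_inverse\<close> then returns \<^const>\<open>None\<close>.\<close>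

definition mat_inv :: "real mat \<Rightarrow> real mat" where
  "mat_inv A = the (mat_inverse A)"

definition mat_prod_list :: "nat \<Rightarrow> real mat list \<Rightarrow> real mat" where
  "mat_prod_list n As = foldr (*) As (1\<^sub>m n)"

definition ones_vec :: "nat \<Rightarrow> real vec" where
  "ones_vec n = vec n (\<lambda>_. 1)"

section \<open>Classes of matrices\<close>

definition totally_nonnegative :: "real mat \<Rightarrow> bool" where
  "totally_nonnegative A \<longleftrightarrow>
     (\<forall>I J. I \<subseteq> {..<dim_row A} \<longrightarrow> J \<subseteq> {..<dim_col A} \<longrightarrow> card I = card J \<longrightarrow>
        0 \<le> det (submatrix A I J))"

definition comparison_mat :: "real mat \<Rightarrow> real mat" where
  "comparison_mat X =
     mat (dim_row X) (dim_col X) (\<lambda>(i, j). if i = j then \<bar>X $$ (i, j)\<bar> else - \<bar>X $$ (i, j)\<bar>)"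

definition upper_bidiagonal :: "real mat \<Rightarrow> bool" where
  "upper_bidiagonal B \<longleftrightarrow>
     (\<forall>i<dim_row B. \<forall>j<dim_col B. B $$ (i, j) \<noteq> 0 \<longrightarrow> j = i \<or> j = Suc i)"

definition lower_bidiagonal :: "real mat \<Rightarrow> bool" where
  "lower_bidiagonal B \<longleftrightarrow> upper_bidiagonal (transpose_mat B)"

definition unit_diagonal :: "real mat \<Rightarrow> bool" where
  "unit_diagonal B \<longleftrightarrow> (\<forall>i<dim_row B. B $$ (i, i) = 1)"

text \<open>The first \<open>i - 1\<close> entries along the subdiagonal vanish and the others are nonnegative.\<close>

definition subdiagonal_pattern :: "nat \<Rightarrow> real mat \<Rightarrow> bool" where
  "subdiagonal_pattern i B \<longleftrightarrow>
     (\<forall>k\<in>{1..<dim_row B}. if k \<le> i - 1 then B $$ (k, k - 1) = 0 else 0 \<le> B $$ (k, k - 1))"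

definition bidiagonal_factors ::
    "nat \<Rightarrow> (nat \<Rightarrow> real mat) \<Rightarrow> real mat \<Rightarrow> (nat \<Rightarrow> real mat) \<Rightarrow> bool" where
  "bidiagonal_factors n L D U \<longleftrightarrow>
     D \<in> carrier_mat n n \<and> diagonal_mat D \<and> (\<forall>i<n. 0 < D $$ (i, i)) \<and>
     (\<forall>i\<in>{1..<n}.
        L i \<in> carrier_mat n n \<and> lower_bidiagonal (L i) \<and> unit_diagonal (L i) \<and>
        subdiagonal_pattern i (L i) \<and>
        U i \<in> carrier_mat n n \<and> upper_bidiagonal (U i) \<and> unit_diagonal (U i) \<and>
        subdiagonal_pattern i (transpose_mat (U i)))"

section \<open>Arithmetic and flop counting\<close>

datatype arith_op = Add | Sub | Mul | Div

fun exact :: "arith_op \<Rightarrow> real \<Rightarrow> real \<Rightarrow> real" where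
  "exact Add x y = x + y"
| "exact Sub x y = x - y"
| "exact Mul x y = x * y"
| "exact Div x y = x / y"

text \<open>
  The set \<open>F\<close> of floating-point numbers is kept abstract. It contains \<open>1\<close>, is closed under change of
  sign and under the rounded operations \<open>fl op\<close> (so there is no overflow or underflow).
\<close>

definition standard_model ::
    "real set \<Rightarrow> (arith_op \<Rightarrow> real \<Rightarrow> real \<Rightarrow> real) \<Rightarrow> real \<Rightarrow> bool" where
  "standard_model F fl u \<longleftrightarrow>
     0 \<le> u \<and> 1 \<in> F \<and> (\<forall>x\<in>F. - x \<in> F) \<and>
     (\<forall>op. \<forall>x\<in>F. \<forall>y\<in>F. (op = Div \<longrightarrow> y \<noteq> 0) \<longrightarrow>
        fl op x y \<in> F \<and> (\<exists>\<delta>. \<bar>\<delta>\<bar> \<le> u \<and> fl op x y = exact op x y * (1 + \<delta>)))"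

text \<open>
  Algorithms are parametrised by the arithmetic \<open>ar\<close> (either \<^const>\<open>exact\<close> or a rounded one). Each
  scalar operation goes through \<open>flop\<close>, which increments the counter held in the state.
\<close>

type_synonym arith = "arith_op \<Rightarrow> real \<Rightarrow> real \<Rightarrow> real"
type_synonym 'a computation = "(nat, 'a) state"

definition flop :: "arith \<Rightarrow> arith_op \<Rightarrow> real \<Rightarrow> real \<Rightarrow> real computation" where
  "flop ar op x y = State (\<lambda>k. (ar op x y, Suc k))"

definition result :: "'a computation \<Rightarrow> 'a" where
  "result m = fst (run_state m 0)"

definition flop_count :: "'a computation \<Rightarrow> nat" where
  "flop_count m = snd (run_state m 0)"

fun for_each :: "'i list \<Rightarrow> ('i \<Rightarrow> 'a \<Rightarrow> 'a computation) \<Rightarrow> 'a \<Rightarrow> 'a computation" where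
  "for_each [] f x = State_Monad.return x"
| "for_each (i # is) f x = do { y \<leftarrow> f i x; for_each is f y }"

section \<open>Products and substitutions with diagonal and unit bidiagonal matrices\<close>

text \<open>
  All of these work in place, i.e.\ the argument vector is overwritten entry by entry. The index
  order of each loop determines whether the neighbouring entry that is read is an old one (products)
  or an already computed one (substitutions). Unit diagonal entries cost no operation.
\<close>

text \<open>\<open>x\<^sub>i := x\<^sub>i op (a x\<^sub>j)\<close>\<close>

definition update_entry ::
    "arith \<Rightarrow> arith_op \<Rightarrow> real \<Rightarrow> nat \<Rightarrow> nat \<Rightarrow> real vec \<Rightarrow> real vec computation" where
  "update_entry ar op a i j x = do {
     t \<leftarrow> flop ar Mul a (x $ j);
     s \<leftarrow> flop ar op (x $ i) t;
     State_Monad.return (x |\<^sub>v i \<mapsto> s)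
   }"

definition mult_unit_lower :: "arith \<Rightarrow> real mat \<Rightarrow> real vec \<Rightarrow> real vec computation" where
  "mult_unit_lower ar B =
     for_each (rev [1..<dim_row B]) (\<lambda>k. update_entry ar Add (B $$ (k, k - 1)) k (k - 1))"

definition mult_unit_upper :: "arith \<Rightarrow> real mat \<Rightarrow> real vec \<Rightarrow> real vec computation" where
  "mult_unit_upper ar B =
     for_each [1..<dim_row B] (\<lambda>k. update_entry ar Add (B $$ (k - 1, k)) (k - 1) k)"

definition mult_diagonal :: "arith \<Rightarrow> real mat \<Rightarrow> real vec \<Rightarrow> real vec computation" where
  "mult_diagonal ar D =
     for_each [0..<dim_row D]
       (\<lambda>k x. do { s \<leftarrow> flop ar Mul (D $$ (k, k)) (x $ k); State_Monad.return (x |\<^sub>v k \<mapsto> s) })"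

definition solve_unit_lower :: "arith \<Rightarrow> real mat \<Rightarrow> real vec \<Rightarrow> real vec computation" where
  "solve_unit_lower ar B =
     for_each [1..<dim_row B] (\<lambda>k. update_entry ar Sub (B $$ (k, k - 1)) k (k - 1))"

definition solve_unit_upper :: "arith \<Rightarrow> real mat \<Rightarrow> real vec \<Rightarrow> real vec computation" where
  "solve_unit_upper ar B =
     for_each (rev [1..<dim_row B]) (\<lambda>k. update_entry ar Sub (B $$ (k - 1, k)) (k - 1) k)"

definition solve_diagonal :: "arith \<Rightarrow> real mat \<Rightarrow> real vec \<Rightarrow> real vec computation" where
  "solve_diagonal ar D =
     for_each [0..<dim_row D]
       (\<lambda>k x. do { s \<leftarrow> flop ar Div (x $ k) (D $$ (k, k)); State_Monad.return (x |\<^sub>v k \<mapsto> s) })"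

section \<open>Evaluation of the norms and of the condition number\<close>

text \<open>Taking absolute values, changing signs and comparing are not flops and incur no rounding.\<close>

definition eval_norm ::
    "arith \<Rightarrow> nat \<Rightarrow> (nat \<Rightarrow> real mat) \<Rightarrow> real mat \<Rightarrow> (nat \<Rightarrow> real mat) \<Rightarrow> real computation" where
  "eval_norm ar n L D U = do {
     x \<leftarrow> for_each (rev [1..<n]) (\<lambda>i. mult_unit_upper ar (U i)) (ones_vec n);
     y \<leftarrow> mult_diagonal ar D x;
     z \<leftarrow> for_each [1..<n] (\<lambda>i. mult_unit_lower ar (L i)) y;
     State_Monad.return (vec_norm_inf z)
   }"

definition eval_inverse_norm ::
    "arith \<Rightarrow> nat \<Rightarrow> (nat \<Rightarrow> real mat) \<Rightarrow> real mat \<Rightarrow> (nat \<Rightarrow> real mat) \<Rightarrow> real computation" where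
  "eval_inverse_norm ar n L D U = do {
     x \<leftarrow> for_each (rev [1..<n]) (\<lambda>i. solve_unit_lower ar (comparison_mat (L i))) (ones_vec n);
     y \<leftarrow> solve_diagonal ar D x;
     z \<leftarrow> for_each [1..<n] (\<lambda>i. solve_unit_upper ar (comparison_mat (U i))) y;
     State_Monad.return (vec_norm_inf z)
   }"

definition eval_cond ::
    "arith \<Rightarrow> nat \<Rightarrow> (nat \<Rightarrow> real mat) \<Rightarrow> real mat \<Rightarrow> (nat \<Rightarrow> real mat) \<Rightarrow> real computation" where
  "eval_cond ar n L D U = do {
     a \<leftarrow> eval_norm ar n L D U;
     c \<leftarrow> eval_inverse_norm ar n L D U;
     flop ar Mul a c
   }"

definition cond_inf :: "real mat \<Rightarrow> real" where
  "cond_inf A = mat_norm_inf A * mat_norm_inf (mat_inv A)"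

end

theory Submission
  imports Defs
begin

text \<open>
  The signs in the inverse of a product of nonnegative bidiagonal matrices form a checkerboard.
  Conjugation by the diagonal matrix with alternating diagonal \<open>1, -1, 1, \<dots>\<close> maps each factor \<open>B\<close> to its
  comparison matrix \<open>M(B)\<close>, and conjugation commutes with products and inverses. Hence it maps \<open>A\<^sup>-\<^sup>1\<close>
  to the product \<open>P\<close> of the matrices \<open>M(B)\<^sup>-\<^sup>1\<close> in reverse order. Substitution with \<open>M(B)\<close> only adds and
  multiplies nonnegative numbers, so every \<open>M(B)\<^sup>-\<^sup>1\<close> is nonnegative and \<open>P\<close> is the entrywise absolute
  value of \<open>A\<^sup>-\<^sup>1\<close> (\<open>abs_inverse_of_product\<close>). The infinity norm of a matrix is that of the vector of
  its absolute row sums (\<open>mat_norm_inf_of_abs\<close>), here \<open>P e\<close>; for \<open>A\<close> itself, which is a product of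
  nonnegative matrices, it is \<open>A e\<close>.

  The absence of cancellation also governs the rounding errors. If all entries of a nonnegative vector are
  known up to factors between \<open>(1 - u)\<^sup>m\<close> and \<open>(1 + u)\<^sup>m\<close>, then after a substitution step of \<open>r\<close> flops
  the same holds with \<open>m + r\<close> in place of \<open>m\<close>. Thus the number of flops itself serves as the exponent
  (\<open>vec_close_inverse_sweeps\<close>). As this number is at most \<open>4n\<^sup>2\<close>, one count settles both the
  complexity and the accuracy.
\<close>

section \<open>Flop-counted computations as pure functions\<close>

text \<open>
  The algorithms never read the counter, so each amounts to a value together with a number of flops.
  This separates the counting from the loops, which become plain folds.
\<close>

definition yields :: "'a computation \<Rightarrow> nat \<Rightarrow> 'a \<Rightarrow> bool" where
  "yields m k y \<longleftrightarrow> (\<forall>s. run_state m s = (y, s + k))"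

lemma result_yields: "yields m k y \<Longrightarrow> result m = y"
  and flop_count_yields: "yields m k y \<Longrightarrow> flop_count m = k"
  by (simp_all add: yields_def result_def flop_count_def)

lemma yields_return: "yields (State_Monad.return x) 0 x"
  by (simp add: yields_def)

lemma yields_flop: "yields (flop ar op x y) 1 (ar op x y)"
  by (simp add: yields_def flop_def)

lemma yields_bind:
  "yields m k y \<Longrightarrow> yields (f y) l z \<Longrightarrow> yields (State_Monad.bind m f) (k + l) z"
  by (simp add: yields_def add.assoc)

lemma yields_for_each:
  assumes "\<And>i x. i \<in> set is \<Longrightarrow> yields (f i x) k (g i x)"
  shows "yields (for_each is f x) (length is * k) (fold g is x)"
  using assms
proof (induction "is" arbitrary: x)
  case Nil
  show ?case by (simp add: yields_return)
next
  case (Cons i "is")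
  have "yields (f i x) k (g i x)" by (rule Cons.prems) simp
  moreover have "yields (for_each is f (g i x)) (length is * k) (fold g is (g i x))"
    by (rule Cons.IH) (simp add: Cons.prems)
  ultimately show ?case
    using yields_bind[of "f i x" k "g i x" "for_each is f"] by simp
qed

section \<open>Loops that overwrite a vector in place\<close>

definition overwrite ::
    "(nat \<Rightarrow> real \<Rightarrow> real \<Rightarrow> real) \<Rightarrow> (nat \<Rightarrow> nat) \<Rightarrow> (nat \<Rightarrow> nat) \<Rightarrow> nat \<Rightarrow> real vec \<Rightarrow> real vec" where
  "overwrite h t s k x = x |\<^sub>v t k \<mapsto> h k (x $ t k) (x $ s k)"

lemma dim_overwrite [simp]: "dim_vec (overwrite h t s k x) = dim_vec x"
  by (simp add: overwrite_def)

lemma dim_fold_overwrite [simp]: "dim_vec (fold (overwrite h t s) ks x) = dim_vec x"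
  by (induction ks arbitrary: x) simp_all

lemma fold_overwrite_untouched:
  "i \<notin> t ` set ks \<Longrightarrow> fold (overwrite h t s) ks x $ i = x $ i"
  by (induction ks arbitrary: x) (auto simp: overwrite_def)

text \<open>
  The source entry of step \<open>k\<close> holds its initial value if no earlier step writes to it, and its final
  value if neither step \<open>k\<close> nor a later one does. The first case yields matrix--vector products,
  the second one substitutions.
\<close>

lemma
  assumes "t k < dim_vec x" "t k \<notin> t ` set ps" "t k \<notin> t ` set qs"
    and y: "y = fold (overwrite h t s) (ps @ k # qs) x"
  shows fold_overwrite_old: "s k \<notin> t ` set ps \<Longrightarrow> y $ t k = h k (x $ t k) (x $ s k)"
    and fold_overwrite_new: "s k \<notin> t ` set (k # qs) \<Longrightarrow> y $ t k = h k (x $ t k) (y $ s k)"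
proof -
  define w where "w = fold (overwrite h t s) ps x"
  have y': "y = fold (overwrite h t s) qs (overwrite h t s k w)"
    by (simp add: y w_def)
  have "w $ t k = x $ t k"
    unfolding w_def by (rule fold_overwrite_untouched) fact
  moreover have "y $ t k = overwrite h t s k w $ t k"
    unfolding y' by (rule fold_overwrite_untouched) fact
  ultimately have *: "y $ t k = h k (x $ t k) (w $ s k)"
    using assms(1) by (simp add: overwrite_def w_def)
  show "y $ t k = h k (x $ t k) (x $ s k)" if "s k \<notin> t ` set ps"
    using that * fold_overwrite_untouched[of "s k" t ps h s x] by (simp add: w_def)
  show "y $ t k = h k (x $ t k) (y $ s k)" if "s k \<notin> t ` set (k # qs)"
  proof -
    have "y $ s k = w $ s k"
      using fold_overwrite_untouched[of "s k" t "k # qs" h s w] that by (simp add: y')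
    with * show ?thesis by simp
  qed
qed

lemma upt_split_at: "1 \<le> k \<Longrightarrow> k < n \<Longrightarrow> [1..<n] = [1..<k] @ k # [Suc k..<n]"
  by (metis less_imp_le_nat upt_add_eq_append upt_conv_Cons le_add_diff_inverse)

definition lower_sweep ::
    "arith \<Rightarrow> arith_op \<Rightarrow> real mat \<Rightarrow> nat list \<Rightarrow> real vec \<Rightarrow> real vec" where
  "lower_sweep ar op B =
     fold (overwrite (\<lambda>k a c. ar op a (ar Mul (B $$ (k, k - 1)) c)) (\<lambda>k. k) (\<lambda>k. k - 1))"

definition upper_sweep ::
    "arith \<Rightarrow> arith_op \<Rightarrow> real mat \<Rightarrow> nat list \<Rightarrow> real vec \<Rightarrow> real vec" where
  "upper_sweep ar op B =
     fold (overwrite (\<lambda>k a c. ar op a (ar Mul (B $$ (k - 1, k)) c)) (\<lambda>k. k - 1) (\<lambda>k. k))"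

definition diagonal_sweep :: "(real \<Rightarrow> real \<Rightarrow> real) \<Rightarrow> real mat \<Rightarrow> nat list \<Rightarrow> real vec \<Rightarrow> real vec" where
  "diagonal_sweep f D = fold (overwrite (\<lambda>k a c. f (D $$ (k, k)) a) (\<lambda>k. k) (\<lambda>k. k))"

lemma dim_sweeps [simp]:
  "dim_vec (lower_sweep ar op B ks x) = dim_vec x"
  "dim_vec (upper_sweep ar op B ks x) = dim_vec x"
  "dim_vec (diagonal_sweep f D ks x) = dim_vec x"
  by (simp_all add: lower_sweep_def upper_sweep_def diagonal_sweep_def)

lemma yields_update_entry:
  "yields (update_entry ar op a i j x) 2 (x |\<^sub>v i \<mapsto> ar op (x $ i) (ar Mul a (x $ j)))"
  by (simp add: update_entry_def yields_def flop_def)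

lemma yields_sweeps:
  assumes "dim_row B = n"
  shows "yields (mult_unit_lower ar B x) (2 * (n - 1)) (lower_sweep ar Add B (rev [1..<n]) x)"
    and "yields (mult_unit_upper ar B x) (2 * (n - 1)) (upper_sweep ar Add B [1..<n] x)"
    and "yields (solve_unit_lower ar B x) (2 * (n - 1)) (lower_sweep ar Sub B [1..<n] x)"
    and "yields (solve_unit_upper ar B x) (2 * (n - 1)) (upper_sweep ar Sub B (rev [1..<n]) x)"
    and "yields (mult_diagonal ar B x) n (diagonal_sweep (ar Mul) B [0..<n] x)"
    and "yields (solve_diagonal ar B x) n (diagonal_sweep (\<lambda>d a. ar Div a d) B [0..<n] x)"
proof -
  have "yields (mult_unit_lower ar B x) (length (rev [1..<n]) * 2)
      (lower_sweep ar Add B (rev [1..<n]) x)"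
    unfolding mult_unit_lower_def lower_sweep_def assms
    by (rule yields_for_each) (simp add: overwrite_def yields_update_entry)
  then show "yields (mult_unit_lower ar B x) (2 * (n - 1))
      (lower_sweep ar Add B (rev [1..<n]) x)"
    by (simp add: mult.commute)
  have "yields (mult_unit_upper ar B x) (length [1..<n] * 2) (upper_sweep ar Add B [1..<n] x)"
    unfolding mult_unit_upper_def upper_sweep_def assms
    by (rule yields_for_each) (simp add: overwrite_def yields_update_entry)
  then show "yields (mult_unit_upper ar B x) (2 * (n - 1)) (upper_sweep ar Add B [1..<n] x)"
    by (simp add: mult.commute)
  have "yields (solve_unit_lower ar B x) (length [1..<n] * 2) (lower_sweep ar Sub B [1..<n] x)"
    unfolding solve_unit_lower_def lower_sweep_def assms
    by (rule yields_for_each) (simp add: overwrite_def yields_update_entry)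
  then show "yields (solve_unit_lower ar B x) (2 * (n - 1)) (lower_sweep ar Sub B [1..<n] x)"
    by (simp add: mult.commute)
  have "yields (solve_unit_upper ar B x) (length (rev [1..<n]) * 2)
      (upper_sweep ar Sub B (rev [1..<n]) x)"
    unfolding solve_unit_upper_def upper_sweep_def assms
    by (rule yields_for_each) (simp add: overwrite_def yields_update_entry)
  then show "yields (solve_unit_upper ar B x) (2 * (n - 1))
      (upper_sweep ar Sub B (rev [1..<n]) x)"
    by (simp add: mult.commute)
  have "yields (mult_diagonal ar B x) (length [0..<n] * 1) (diagonal_sweep (ar Mul) B [0..<n] x)"
    unfolding mult_diagonal_def diagonal_sweep_def assms
    by (rule yields_for_each) (simp add: overwrite_def yields_def flop_def)
  then show "yields (mult_diagonal ar B x) n (diagonal_sweep (ar Mul) B [0..<n] x)"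
    by simp
  have "yields (solve_diagonal ar B x) (length [0..<n] * 1)
      (diagonal_sweep (\<lambda>d a. ar Div a d) B [0..<n] x)"
    unfolding solve_diagonal_def diagonal_sweep_def assms
    by (rule yields_for_each) (simp add: overwrite_def yields_def flop_def)
  then show "yields (solve_diagonal ar B x) n (diagonal_sweep (\<lambda>d a. ar Div a d) B [0..<n] x)"
    by simp
qed

section \<open>Exact sweeps are products and substitutions\<close>

lemma sparse_row_mult_vec:
  assumes B: "B \<in> carrier_mat n n" and y: "y \<in> carrier_vec n" and i: "i < n"
    and nz: "\<And>j. j < n \<Longrightarrow> B $$ (i, j) \<noteq> 0 \<Longrightarrow> j \<in> S" and S: "S \<subseteq> {..<n}"
  shows "(B *\<^sub>v y) $ i = (\<Sum>j\<in>S. B $$ (i, j) * y $ j)"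
proof -
  have "(B *\<^sub>v y) $ i = (\<Sum>j<n. B $$ (i, j) * y $ j)"
    using B y i by (auto simp: mult_mat_vec_def scalar_prod_def atLeast0LessThan intro!: sum.cong)
  also have "\<dots> = (\<Sum>j\<in>S. B $$ (i, j) * y $ j)"
    using nz S by (intro sum.mono_neutral_right) force+
  finally show ?thesis .
qed

lemma lower_bidiagonal_mult_vec:
  assumes B: "B \<in> carrier_mat n n" "lower_bidiagonal B" "unit_diagonal B"
    and y: "y \<in> carrier_vec n"
  shows "0 < n \<Longrightarrow> (B *\<^sub>v y) $ 0 = y $ 0"
    and "1 \<le> k \<Longrightarrow> k < n \<Longrightarrow> (B *\<^sub>v y) $ k = y $ k + B $$ (k, k - 1) * y $ (k - 1)"
proof -
  have nz: "j = i \<or> i = Suc j" if "i < n" "j < n" "B $$ (i, j) \<noteq> 0" for i j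
    using B that by (auto simp: lower_bidiagonal_def upper_bidiagonal_def)
  have diag: "B $$ (i, i) = 1" if "i < n" for i
    using B that by (auto simp: unit_diagonal_def)
  show "(B *\<^sub>v y) $ 0 = y $ 0" if "0 < n"
    using sparse_row_mult_vec[OF B(1) y that, of "{0}"] nz[of 0] that by (auto simp: diag)
  show "(B *\<^sub>v y) $ k = y $ k + B $$ (k, k - 1) * y $ (k - 1)" if k: "1 \<le> k" "k < n"
  proof -
    have "k \<noteq> k - 1" using k by simp
    moreover have "j \<in> {k, k - 1}" if "j < n" "B $$ (k, j) \<noteq> 0" for j
      using nz[of k j] that k by auto
    ultimately show ?thesis
      using sparse_row_mult_vec[OF B(1) y k(2), of "{k, k - 1}"] k by (auto simp: diag)
  qed
qed

lemma upper_bidiagonal_mult_vec: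
  assumes B: "B \<in> carrier_mat n n" "upper_bidiagonal B" "unit_diagonal B"
    and y: "y \<in> carrier_vec n"
  shows "0 < n \<Longrightarrow> (B *\<^sub>v y) $ (n - 1) = y $ (n - 1)"
    and "1 \<le> k \<Longrightarrow> k < n \<Longrightarrow> (B *\<^sub>v y) $ (k - 1) = y $ (k - 1) + B $$ (k - 1, k) * y $ k"
proof -
  have nz: "j = i \<or> j = Suc i" if "i < n" "j < n" "B $$ (i, j) \<noteq> 0" for i j
    using B that by (auto simp: upper_bidiagonal_def)
  have diag: "B $$ (i, i) = 1" if "i < n" for i
    using B that by (auto simp: unit_diagonal_def)
  show "(B *\<^sub>v y) $ (n - 1) = y $ (n - 1)" if "0 < n"
    using sparse_row_mult_vec[OF B(1) y, of "n - 1" "{n - 1}"] nz[of "n - 1"] that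
    by (auto simp: diag)
  show "(B *\<^sub>v y) $ (k - 1) = y $ (k - 1) + B $$ (k - 1, k) * y $ k" if k: "1 \<le> k" "k < n"
  proof -
    have "k \<noteq> k - 1" using k by simp
    moreover have "j \<in> {k - 1, k}" if "j < n" "B $$ (k - 1, j) \<noteq> 0" for j
      using nz[of "k - 1" j] that k by auto
    ultimately show ?thesis
      using sparse_row_mult_vec[OF B(1) y, of "k - 1" "{k - 1, k}"] k by (auto simp: diag)
  qed
qed

lemma diagonal_mult_vec:
  assumes D: "D \<in> carrier_mat n n" "diagonal_mat D" and y: "y \<in> carrier_vec n" and k: "k < n"
  shows "(D *\<^sub>v y) $ k = D $$ (k, k) * y $ k"
  using sparse_row_mult_vec[OF D(1) y k, of "{k}"] D k by (auto simp: diagonal_mat_def)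

lemma lower_sweep_mult:
  assumes B: "B \<in> carrier_mat n n" "lower_bidiagonal B" "unit_diagonal B"
    and x: "x \<in> carrier_vec n"
  shows "lower_sweep exact Add B (rev [1..<n]) x = B *\<^sub>v x" (is "?y = _")
proof (rule eq_vecI)
  show "dim_vec ?y = dim_vec (B *\<^sub>v x)" using B x by simp
  fix k assume "k < dim_vec (B *\<^sub>v x)"
  then have k: "k < n" using B by simp
  show "?y $ k = (B *\<^sub>v x) $ k"
  proof (cases "k = 0")
    case True
    then show ?thesis
      using lower_bidiagonal_mult_vec(1)[OF B x] k
      by (simp add: lower_sweep_def fold_overwrite_untouched)
  next
    case False
    then have k1: "1 \<le> k" by simp
    have "?y $ k = exact Add (x $ k) (exact Mul (B $$ (k, k - 1)) (x $ (k - 1)))"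
      unfolding lower_sweep_def upt_split_at[OF k1 k]
      by (rule fold_overwrite_old[where ps = "rev [Suc k..<n]" and qs = "rev [1..<k]"])
         (use x k in auto)
    then show ?thesis using lower_bidiagonal_mult_vec(2)[OF B x k1 k] by simp
  qed
qed

lemma upper_sweep_mult:
  assumes B: "B \<in> carrier_mat n n" "upper_bidiagonal B" "unit_diagonal B"
    and x: "x \<in> carrier_vec n"
  shows "upper_sweep exact Add B [1..<n] x = B *\<^sub>v x" (is "?y = _")
proof (rule eq_vecI)
  show "dim_vec ?y = dim_vec (B *\<^sub>v x)" using B x by simp
  fix i assume "i < dim_vec (B *\<^sub>v x)"
  then have i: "i < n" using B by simp
  show "?y $ i = (B *\<^sub>v x) $ i"
  proof (cases "i = n - 1")
    case True
    have "?y $ (n - 1) = x $ (n - 1)"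
      unfolding upper_sweep_def by (rule fold_overwrite_untouched) auto
    then show ?thesis using True upper_bidiagonal_mult_vec(1)[OF B x] i by simp
  next
    case False
    define k where "k = Suc i"
    have k: "1 \<le> k" "k < n" "i = k - 1" using False i by (auto simp: k_def)
    have "?y $ (k - 1) = exact Add (x $ (k - 1)) (exact Mul (B $$ (k - 1, k)) (x $ k))"
      unfolding upper_sweep_def upt_split_at[OF k(1,2)]
      by (rule fold_overwrite_old[where ps = "[1..<k]" and qs = "[Suc k..<n]"])
         (use x k in auto)
    then show ?thesis using upper_bidiagonal_mult_vec(2)[OF B x k(1,2)] k by simp
  qed
qed

lemma lower_sweep_solve:
  assumes B: "B \<in> carrier_mat n n" "lower_bidiagonal B" "unit_diagonal B"
    and x: "x \<in> carrier_vec n"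
  shows "B *\<^sub>v lower_sweep exact Sub B [1..<n] x = x" (is "_ *\<^sub>v ?y = _")
proof (rule eq_vecI)
  have y: "?y \<in> carrier_vec n" using x by (intro carrier_vecI) simp
  show "dim_vec (B *\<^sub>v ?y) = dim_vec x" using B x by simp
  fix k assume "k < dim_vec x"
  then have k: "k < n" using x by simp
  show "(B *\<^sub>v ?y) $ k = x $ k"
  proof (cases "k = 0")
    case True
    then show ?thesis
      using lower_bidiagonal_mult_vec(1)[OF B y] k
      by (simp add: lower_sweep_def fold_overwrite_untouched)
  next
    case False
    then have k1: "1 \<le> k" by simp
    have split: "?y = fold (overwrite (\<lambda>k a c. exact Sub a (exact Mul (B $$ (k, k - 1)) c)) (\<lambda>k. k)
        (\<lambda>k. k - 1)) ([1..<k] @ k # [Suc k..<n]) x"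
      unfolding lower_sweep_def upt_split_at[OF k1 k] ..
    have "?y $ k = exact Sub (x $ k) (exact Mul (B $$ (k, k - 1)) (?y $ (k - 1)))"
      by (rule fold_overwrite_new[where ps = "[1..<k]" and qs = "[Suc k..<n]", OF _ _ _ split])
         (use x k k1 in auto)
    then show ?thesis using lower_bidiagonal_mult_vec(2)[OF B y k1 k] by simp
  qed
qed

lemma upper_sweep_solve:
  assumes B: "B \<in> carrier_mat n n" "upper_bidiagonal B" "unit_diagonal B"
    and x: "x \<in> carrier_vec n"
  shows "B *\<^sub>v upper_sweep exact Sub B (rev [1..<n]) x = x" (is "_ *\<^sub>v ?y = _")
proof (rule eq_vecI)
  have y: "?y \<in> carrier_vec n" using x by (intro carrier_vecI) simp
  show "dim_vec (B *\<^sub>v ?y) = dim_vec x" using B x by simp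
  fix i assume "i < dim_vec x"
  then have i: "i < n" using x by simp
  show "(B *\<^sub>v ?y) $ i = x $ i"
  proof (cases "i = n - 1")
    case True
    have "?y $ (n - 1) = x $ (n - 1)"
      unfolding upper_sweep_def by (rule fold_overwrite_untouched) auto
    then show ?thesis using True upper_bidiagonal_mult_vec(1)[OF B y] i by simp
  next
    case False
    define k where "k = Suc i"
    have k: "1 \<le> k" "k < n" "i = k - 1" using False i by (auto simp: k_def)
    have split: "?y = fold (overwrite (\<lambda>k a c. exact Sub a (exact Mul (B $$ (k - 1, k)) c))
        (\<lambda>k. k - 1) (\<lambda>k. k)) (rev [Suc k..<n] @ k # rev [1..<k]) x"
      unfolding upper_sweep_def upt_split_at[OF k(1,2)] by simp
    have "?y $ (k - 1) = exact Sub (x $ (k - 1)) (exact Mul (B $$ (k - 1, k)) (?y $ k))"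
      by (rule fold_overwrite_new[where ps = "rev [Suc k..<n]" and qs = "rev [1..<k]",
            OF _ _ _ split])
         (use x k in auto)
    then show ?thesis using upper_bidiagonal_mult_vec(2)[OF B y k(1,2)] k by simp
  qed
qed

lemma diagonal_sweep_index:
  assumes "k < n" "n = dim_vec x"
  shows "diagonal_sweep f D [0..<n] x $ k = f (D $$ (k, k)) (x $ k)"
proof -
  have "[0..<n] = [0..<k] @ k # [Suc k..<n]"
    using assms(1) by (metis le_add_diff_inverse less_imp_le_nat upt_add_eq_append upt_conv_Cons zero_le)
  then have "diagonal_sweep f D [0..<n] x =
      fold (overwrite (\<lambda>k a c. f (D $$ (k, k)) a) (\<lambda>k. k) (\<lambda>k. k)) ([0..<k] @ k # [Suc k..<n]) x"
    unfolding diagonal_sweep_def by simp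
  from fold_overwrite_old[OF _ _ _ this] show ?thesis using assms by simp
qed

lemma diagonal_sweep_mult:
  assumes D: "D \<in> carrier_mat n n" "diagonal_mat D" and x: "x \<in> carrier_vec n"
  shows "diagonal_sweep (exact Mul) D [0..<n] x = D *\<^sub>v x"
  using D x diagonal_mult_vec[OF D x] by (intro eq_vecI) (auto simp: diagonal_sweep_index)

lemma diagonal_sweep_solve:
  assumes D: "D \<in> carrier_mat n n" "diagonal_mat D" and nz: "\<And>k. k < n \<Longrightarrow> D $$ (k, k) \<noteq> 0"
    and x: "x \<in> carrier_vec n"
  shows "D *\<^sub>v diagonal_sweep (\<lambda>d a. exact Div a d) D [0..<n] x = x" (is "_ *\<^sub>v ?y = _")
proof -
  have "?y \<in> carrier_vec n" using x by (intro carrier_vecI) simp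
  then show ?thesis
    using D x nz diagonal_mult_vec[OF D, of ?y] by (intro eq_vecI) (auto simp: diagonal_sweep_index)
qed

section \<open>Propagation of rounding errors\<close>

text \<open>
  The exponent counts roundings. Sums, and products with nonnegative exact data, of nonnegative
  numbers do not enlarge relative perturbations, so only roundings increase it.
\<close>

definition rel_close :: "real \<Rightarrow> nat \<Rightarrow> real \<Rightarrow> real \<Rightarrow> bool" where
  "rel_close u m x' x \<longleftrightarrow> 0 \<le> x \<and> (1 - u) ^ m * x \<le> x' \<and> x' \<le> (1 + u) ^ m * x"

lemma rel_close_round:
  assumes x: "rel_close u m x' x" and u: "u \<le> 1" and d: "\<bar>\<delta>\<bar> \<le> u"
  shows "rel_close u (Suc m) (x' * (1 + \<delta>)) x"
proof -
  have "0 \<le> (1 - u) ^ m * x" using x u by (simp add: rel_close_def)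
  then have x'0: "0 \<le> x'" using x by (simp add: rel_close_def)
  have "((1 - u) ^ m * x) * (1 - u) \<le> x' * (1 + \<delta>)"
    using x u d x'0 by (intro mult_mono) (auto simp: rel_close_def)
  moreover have "x' * (1 + \<delta>) \<le> ((1 + u) ^ m * x) * (1 + u)"
    using x u d x'0 by (intro mult_mono) (auto simp: rel_close_def)
  ultimately show ?thesis using x by (simp add: rel_close_def mult_ac)
qed

lemma rel_close_mono:
  assumes x: "rel_close u m x' x" and u: "0 \<le> u" "u \<le> 1" and m: "m \<le> m'"
  shows "rel_close u m' x' x"
proof -
  have "(1 - u) ^ m' \<le> (1 - u) ^ m" using u m by (intro power_decreasing) auto
  then have "(1 - u) ^ m' * x \<le> (1 - u) ^ m * x"
    using x by (intro mult_right_mono) (auto simp: rel_close_def)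
  moreover have "(1 + u) ^ m \<le> (1 + u) ^ m'" using u m by (intro power_increasing) auto
  then have "(1 + u) ^ m * x \<le> (1 + u) ^ m' * x"
    using x by (intro mult_right_mono) (auto simp: rel_close_def)
  ultimately show ?thesis using x by (auto simp: rel_close_def)
qed

lemma rel_close_add:
  "rel_close u m x' x \<Longrightarrow> rel_close u m y' y \<Longrightarrow> rel_close u m (x' + y') (x + y)"
  by (simp add: rel_close_def distrib_left add_mono)

lemma rel_close_scale:
  assumes "0 \<le> c" "rel_close u m x' x"
  shows "rel_close u m (c * x') (c * x)"
  using assms mult_left_mono[of "(1 - u) ^ m * x" x' c] mult_left_mono[of x' "(1 + u) ^ m * x" c]
  by (simp add: rel_close_def mult_ac)

lemma standard_modelE:
  assumes "standard_model F fl u" "x \<in> F" "y \<in> F" "op = Div \<Longrightarrow> y \<noteq> 0"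
  obtains \<delta> where "fl op x y \<in> F" "\<bar>\<delta>\<bar> \<le> u" "fl op x y = exact op x y * (1 + \<delta>)"
  using assms unfolding standard_model_def by blast

lemma standard_model_nonneg: "standard_model F fl u \<Longrightarrow> 0 \<le> u"
  by (simp add: standard_model_def)

text \<open>The factor \<open>b\<close> is nonpositive, so the subtraction adds two nonnegative numbers.\<close>

lemma rel_close_sub_mul:
  assumes fl: "standard_model F fl u" and u: "u \<le> 1" and b: "b \<in> F" "b \<le> 0"
    and a: "a' \<in> F" "rel_close u m a' a" and c: "c' \<in> F" "rel_close u m c' c"
  shows "fl Sub a' (fl Mul b c') \<in> F \<and>
    rel_close u (m + 2) (fl Sub a' (fl Mul b c')) (exact Sub a (exact Mul b c))"
proof -
  have u0: "0 \<le> u" by (rule standard_model_nonneg) fact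
  obtain \<delta> where 1: "fl Mul b c' \<in> F" "\<bar>\<delta>\<bar> \<le> u" "fl Mul b c' = b * c' * (1 + \<delta>)"
    using standard_modelE[OF fl b(1) c(1), of Mul] by auto
  obtain \<epsilon> where 2: "fl Sub a' (fl Mul b c') \<in> F" "\<bar>\<epsilon>\<bar> \<le> u"
      "fl Sub a' (fl Mul b c') = (a' - fl Mul b c') * (1 + \<epsilon>)"
    using standard_modelE[OF fl a(1) 1(1), of Sub] by auto
  have "rel_close u (Suc m) ((- b) * c' * (1 + \<delta>)) ((- b) * c)"
    using b c u 1(2) by (intro rel_close_round rel_close_scale) auto
  moreover have "rel_close u (Suc m) a' a"
    by (rule rel_close_mono[OF a(2) u0 u]) simp
  ultimately have "rel_close u (Suc m) (a' + (- b) * c' * (1 + \<delta>)) (a + (- b) * c)"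
    by (intro rel_close_add)
  then have "rel_close u (Suc (Suc m)) ((a' + (- b) * c' * (1 + \<delta>)) * (1 + \<epsilon>)) (a + (- b) * c)"
    using u 2(2) by (rule rel_close_round)
  then have "rel_close u (m + 2) (fl Sub a' (fl Mul b c')) (exact Sub a (exact Mul b c))"
    unfolding 2(3) unfolding 1(3) by simp
  with 2(1) show ?thesis ..
qed

lemma rel_close_div:
  assumes fl: "standard_model F fl u" and u: "u \<le> 1" and d: "d \<in> F" "0 < d"
    and a: "a' \<in> F" "rel_close u m a' a"
  shows "fl Div a' d \<in> F \<and> rel_close u (m + 1) (fl Div a' d) (exact Div a d)"
proof -
  obtain \<delta> where 1: "fl Div a' d \<in> F" "\<bar>\<delta>\<bar> \<le> u" "fl Div a' d = a' / d * (1 + \<delta>)"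
    using standard_modelE[OF fl a(1) d(1), of Div] d(2) by auto
  have "rel_close u (Suc m) (inverse d * a' * (1 + \<delta>)) (inverse d * a)"
    using a d u 1(2) by (intro rel_close_round rel_close_scale) auto
  then have "rel_close u (m + 1) (fl Div a' d) (exact Div a d)"
    by (simp add: 1(3) divide_inverse mult_ac)
  with 1(1) show ?thesis ..
qed

definition vec_close :: "nat \<Rightarrow> real set \<Rightarrow> real \<Rightarrow> nat \<Rightarrow> real vec \<Rightarrow> real vec \<Rightarrow> bool" where
  "vec_close n F u m x' x \<longleftrightarrow> x' \<in> carrier_vec n \<and> x \<in> carrier_vec n \<and>
     (\<forall>i<n. x' $ i \<in> F \<and> rel_close u m (x' $ i) (x $ i))"

lemma vec_close_overwrite:
  assumes x: "vec_close n F u m x' x" and u: "0 \<le> u" "u \<le> 1" and st: "t k < n" "s k < n"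
    and h: "\<And>a' a c' c. a' \<in> F \<Longrightarrow> c' \<in> F \<Longrightarrow> rel_close u m a' a \<Longrightarrow> rel_close u m c' c \<Longrightarrow>
              h' k a' c' \<in> F \<and> rel_close u (m + r) (h' k a' c') (h k a c)"
  shows "vec_close n F u (m + r) (overwrite h' t s k x') (overwrite h t s k x)"
proof -
  have "overwrite h' t s k x' $ i \<in> F \<and>
      rel_close u (m + r) (overwrite h' t s k x' $ i) (overwrite h t s k x $ i)"
    if i: "i < n" for i
  proof (cases "i = t k")
    case True
    then show ?thesis
      using x st h[of "x' $ t k" "x' $ s k" "x $ t k" "x $ s k"]
      by (auto simp: vec_close_def overwrite_def)
  next
    case False
    then show ?thesis
      using x i rel_close_mono[OF _ u, of m "x' $ i" "x $ i" "m + r"]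
      by (simp add: vec_close_def overwrite_def)
  qed
  moreover have "overwrite h' t s k x' \<in> carrier_vec n" "overwrite h t s k x \<in> carrier_vec n"
    using x by (auto simp: vec_close_def intro!: carrier_vecI)
  ultimately show ?thesis unfolding vec_close_def by blast
qed

text \<open>This serves both for the flops of one sweep and for the sequence of sweeps.\<close>

lemma fold_accumulate:
  assumes "\<And>i m x' x. i \<in> set is \<Longrightarrow> R m x' x \<Longrightarrow> R (m + r) (f' i x') (f i x)" and "R m x' x"
  shows "R (m + length is * r) (fold f' is x') (fold f is x)"
  using assms
proof (induction "is" arbitrary: m x' x)
  case (Cons i "is")
  have "R (m + r) (f' i x') (f i x)" using Cons.prems by simp
  then have "R (m + r + length is * r) (fold f' is (f' i x')) (fold f is (f i x))"
    using Cons.prems(1) by (intro Cons.IH) simp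
  then show ?case by (simp add: add_ac)
qed simp

lemma vec_close_lower_sweep:
  assumes fl: "standard_model F fl u" and u: "u \<le> 1" and ks: "set ks \<subseteq> {1..<n}"
    and B: "\<And>k. k \<in> set ks \<Longrightarrow> B $$ (k, k - 1) \<in> F \<and> B $$ (k, k - 1) \<le> 0"
    and x: "vec_close n F u m x' x"
  shows "vec_close n F u (m + length ks * 2) (lower_sweep fl Sub B ks x')
           (lower_sweep exact Sub B ks x)"
  unfolding lower_sweep_def
proof (rule fold_accumulate[where R = "vec_close n F u", OF _ x])
  fix k m x' x assume k: "k \<in> set ks" and x: "vec_close n F u m x' x"
  show "vec_close n F u (m + 2)
         (overwrite (\<lambda>k a c. fl Sub a (fl Mul (B $$ (k, k - 1)) c)) (\<lambda>k. k) (\<lambda>k. k - 1) k x')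
         (overwrite (\<lambda>k a c. exact Sub a (exact Mul (B $$ (k, k - 1)) c)) (\<lambda>k. k) (\<lambda>k. k - 1) k x)"
  proof (rule vec_close_overwrite[OF x standard_model_nonneg[OF fl] u])
    show "k < n" "k - 1 < n" using subsetD[OF ks k] by auto
  qed (rule rel_close_sub_mul[OF fl u B[OF k, THEN conjunct1] B[OF k, THEN conjunct2]], assumption+)
qed

lemma vec_close_upper_sweep:
  assumes fl: "standard_model F fl u" and u: "u \<le> 1" and ks: "set ks \<subseteq> {1..<n}"
    and B: "\<And>k. k \<in> set ks \<Longrightarrow> B $$ (k - 1, k) \<in> F \<and> B $$ (k - 1, k) \<le> 0"
    and x: "vec_close n F u m x' x"
  shows "vec_close n F u (m + length ks * 2) (upper_sweep fl Sub B ks x')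
           (upper_sweep exact Sub B ks x)"
  unfolding upper_sweep_def
proof (rule fold_accumulate[where R = "vec_close n F u", OF _ x])
  fix k m x' x assume k: "k \<in> set ks" and x: "vec_close n F u m x' x"
  show "vec_close n F u (m + 2)
         (overwrite (\<lambda>k a c. fl Sub a (fl Mul (B $$ (k - 1, k)) c)) (\<lambda>k. k - 1) (\<lambda>k. k) k x')
         (overwrite (\<lambda>k a c. exact Sub a (exact Mul (B $$ (k - 1, k)) c)) (\<lambda>k. k - 1) (\<lambda>k. k) k x)"
  proof (rule vec_close_overwrite[OF x standard_model_nonneg[OF fl] u])
    show "k - 1 < n" "k < n" using subsetD[OF ks k] by auto
  qed (rule rel_close_sub_mul[OF fl u B[OF k, THEN conjunct1] B[OF k, THEN conjunct2]], assumption+)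
qed

lemma vec_close_diagonal_sweep:
  assumes fl: "standard_model F fl u" and u: "u \<le> 1" and ks: "set ks \<subseteq> {..<n}"
    and D: "\<And>k. k \<in> set ks \<Longrightarrow> D $$ (k, k) \<in> F \<and> 0 < D $$ (k, k)"
    and x: "vec_close n F u m x' x"
  shows "vec_close n F u (m + length ks * 1) (diagonal_sweep (\<lambda>d a. fl Div a d) D ks x')
           (diagonal_sweep (\<lambda>d a. exact Div a d) D ks x)"
  unfolding diagonal_sweep_def
proof (rule fold_accumulate[where R = "vec_close n F u", OF _ x])
  fix k m x' x assume k: "k \<in> set ks" and x: "vec_close n F u m x' x"
  show "vec_close n F u (m + 1)
         (overwrite (\<lambda>k a c. fl Div a (D $$ (k, k))) (\<lambda>k. k) (\<lambda>k. k) k x')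
         (overwrite (\<lambda>k a c. exact Div a (D $$ (k, k))) (\<lambda>k. k) (\<lambda>k. k) k x)"
  proof (rule vec_close_overwrite[OF x standard_model_nonneg[OF fl] u])
    show "k < n" "k < n" using subsetD[OF ks k] by auto
  qed (rule rel_close_div[OF fl u D[OF k, THEN conjunct1] D[OF k, THEN conjunct2]], assumption+)
qed

lemma vec_close_norm:
  assumes x: "vec_close n F u m x' x" and n: "0 < n" and u: "0 \<le> u" "u \<le> 1"
  shows "rel_close u m (vec_norm_inf x') (vec_norm_inf x)"
proof -
  have dims: "dim_vec x = n" "dim_vec x' = n" using x by (auto simp: vec_close_def)
  have close: "0 \<le> x $ i" "(1 - u) ^ m * x $ i \<le> x' $ i" "x' $ i \<le> (1 + u) ^ m * x $ i"
    if "i < n" for i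
    using x that by (auto simp: vec_close_def rel_close_def)
  have attained: "\<exists>i<n. vec_norm_inf v = \<bar>v $ i\<bar>" if "dim_vec v = n" for v
  proof -
    have "vec_norm_inf v \<in> (\<lambda>i. \<bar>v $ i\<bar>) ` {..<n}"
      unfolding vec_norm_inf_def that using n by (intro Max_in) auto
    then show ?thesis by auto
  qed
  obtain i where i: "i < n" "vec_norm_inf x = \<bar>x $ i\<bar>" using attained dims by blast
  obtain j where j: "j < n" "vec_norm_inf x' = \<bar>x' $ j\<bar>" using attained dims by blast
  have "0 \<le> (1 - u) ^ m * x $ j" using close(1)[OF j(1)] u by simp
  then have "vec_norm_inf x' \<le> (1 + u) ^ m * x $ j"
    using close(2,3)[OF j(1)] j(2) by simp
  also have "\<dots> \<le> (1 + u) ^ m * vec_norm_inf x"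
    using u abs_le_vec_norm_inf[of j x] j(1) dims by (intro mult_left_mono) auto
  finally have "vec_norm_inf x' \<le> (1 + u) ^ m * vec_norm_inf x" .
  moreover have "(1 - u) ^ m * vec_norm_inf x \<le> vec_norm_inf x'"
    using close(1,2)[OF i(1)] i abs_le_vec_norm_inf[of i x'] dims by simp
  ultimately show ?thesis using i(2) by (simp add: rel_close_def)
qed

lemma rel_close_abs_error:
  assumes x: "rel_close u m x' x" and u: "0 \<le> u" "u \<le> 1" and mu: "real m * u \<le> 1"
  shows "\<bar>x' - x\<bar> \<le> 2 * (real m * u) * x"
proof -
  define v where "v = real m * u"
  have x0: "0 \<le> x" using x by (simp add: rel_close_def)
  have v: "0 \<le> v" "v \<le> 1" using u mu by (auto simp: v_def)
  have "(1 + u) ^ m \<le> exp u ^ m" using u by (intro power_mono) auto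
  also have "\<dots> = exp v" by (simp add: v_def exp_of_nat_mult)
  also have "\<dots> \<le> 1 + v + v\<^sup>2" using v by (rule exp_bound)
  also have "\<dots> \<le> 1 + 2 * v"
    using v mult_left_le[of v v] by (simp add: power2_eq_square)
  finally have "(1 + u) ^ m * x \<le> (1 + 2 * v) * x"
    using x0 by (rule mult_right_mono)
  then have upper: "x' \<le> x + 2 * (v * x)"
    using x by (simp add: rel_close_def algebra_simps)
  have "1 + real m * (- u) \<le> (1 + - u) ^ m"
    using u by (intro Bernoulli_inequality) simp
  then have "1 - v \<le> (1 - u) ^ m" by (simp add: v_def)
  then have "(1 - v) * x \<le> (1 - u) ^ m * x" using x0 by (rule mult_right_mono)
  then have "x - v * x \<le> x'" using x by (simp add: rel_close_def algebra_simps)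
  moreover have "0 \<le> v * x" using v x0 by simp
  ultimately have "\<bar>x' - x\<bar> \<le> 2 * (v * x)" using upper by linarith
  then show ?thesis by (simp add: v_def mult.assoc)
qed

lemma standard_model_exact: "standard_model UNIV exact 0"
  unfolding standard_model_def by (intro conjI allI ballI impI exI[of _ 0]) simp_all

lemma vec_close_exact: "vec_close n UNIV 0 m x x \<longleftrightarrow> x \<in> carrier_vec n \<and> (\<forall>i<n. 0 \<le> x $ i)"
  by (auto simp: vec_close_def rel_close_def)

section \<open>Nonnegative matrices and the infinity norm\<close>

definition nonneg_mat :: "real mat \<Rightarrow> bool" where
  "nonneg_mat A \<longleftrightarrow> (\<forall>i<dim_row A. \<forall>j<dim_col A. 0 \<le> A $$ (i, j))"

lemma nonneg_mat_mult:
  assumes "nonneg_mat A" "nonneg_mat B" "dim_col A = dim_row B"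
  shows "nonneg_mat (A * B)"
  unfolding nonneg_mat_def
proof (intro allI impI)
  fix i j assume "i < dim_row (A * B)" "j < dim_col (A * B)"
  with assms show "0 \<le> (A * B) $$ (i, j)"
    by (auto simp: nonneg_mat_def scalar_prod_def intro!: sum_nonneg)
qed

lemma nonneg_mat_one: "nonneg_mat (1\<^sub>m n)"
  by (simp add: nonneg_mat_def)

text \<open>Multiplying \<open>P\<close> by the vector of ones forms its row sums, which are the absolute row sums of \<open>A\<close>.\<close>

lemma mat_norm_inf_of_abs:
  assumes A: "A \<in> carrier_mat n n" and P: "P \<in> carrier_mat n n" and n: "0 < n"
    and abs: "\<And>i j. i < n \<Longrightarrow> j < n \<Longrightarrow> \<bar>A $$ (i, j)\<bar> = P $$ (i, j)"
  shows "mat_norm_inf A = vec_norm_inf (P *\<^sub>v ones_vec n)"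
proof -
  have "\<bar>(P *\<^sub>v ones_vec n) $ i\<bar> = (\<Sum>j<n. \<bar>A $$ (i, j)\<bar>)" if i: "i < n" for i
  proof -
    have "(P *\<^sub>v ones_vec n) $ i = (\<Sum>j<n. \<bar>A $$ (i, j)\<bar>)"
      using P i abs
      by (auto simp: ones_vec_def mult_mat_vec_def scalar_prod_def atLeast0LessThan intro!: sum.cong)
    moreover have "0 \<le> (\<Sum>j<n. \<bar>A $$ (i, j)\<bar>)" by (simp add: sum_nonneg)
    ultimately show ?thesis by simp
  qed
  then have "(\<lambda>i. \<bar>(P *\<^sub>v ones_vec n) $ i\<bar>) ` {..<n} = (\<lambda>i. \<Sum>j<n. \<bar>A $$ (i, j)\<bar>) ` {..<n}"
    by (intro image_cong) auto
  then show ?thesis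
    using P by (simp add: mat_norm_inf_eq_max_row_sum[OF A n n] vec_norm_inf_def)
qed

section \<open>Products of lists of matrices\<close>

lemma mat_prod_list_simps [simp]:
  "mat_prod_list n [] = 1\<^sub>m n"
  "mat_prod_list n (B # Bs) = B * mat_prod_list n Bs"
  by (simp_all add: mat_prod_list_def)

lemma mat_prod_list_carrier:
  "set Bs \<subseteq> carrier_mat n n \<Longrightarrow> mat_prod_list n Bs \<in> carrier_mat n n"
  by (induction Bs) auto

lemma mat_prod_list_append:
  assumes "set As \<subseteq> carrier_mat n n" "set Bs \<subseteq> carrier_mat n n"
  shows "mat_prod_list n (As @ Bs) = mat_prod_list n As * mat_prod_list n Bs"
  using assms(1)
proof (induction As)
  case Nil
  show ?case using mat_prod_list_carrier[OF assms(2)] by simp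
next
  case (Cons A As)
  then show ?case
    using mat_prod_list_carrier[of As n] mat_prod_list_carrier[OF assms(2)]
    by (simp add: assoc_mult_mat[of A n n _ n _ n])
qed

lemma mat_prod_list_mult_vec:
  assumes "set Bs \<subseteq> carrier_mat n n" "x \<in> carrier_vec n"
  shows "mat_prod_list n Bs *\<^sub>v x = foldr (*\<^sub>v) Bs x"
  using assms
proof (induction Bs)
  case (Cons B Bs)
  then show ?case
    using mat_prod_list_carrier[of Bs n]
      assoc_mult_mat_vec[of B n n "mat_prod_list n Bs" n x] by simp
qed simp

lemma nonneg_mat_prod_list:
  "set Bs \<subseteq> carrier_mat n n \<Longrightarrow> (\<And>B. B \<in> set Bs \<Longrightarrow> nonneg_mat B) \<Longrightarrow>
    nonneg_mat (mat_prod_list n Bs)"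
proof (induction Bs)
  case Nil
  show ?case by (simp add: nonneg_mat_one)
next
  case (Cons B Bs)
  have "nonneg_mat (B * mat_prod_list n Bs)"
  proof (rule nonneg_mat_mult)
    show "nonneg_mat B" "nonneg_mat (mat_prod_list n Bs)" using Cons by auto
    show "dim_col B = dim_row (mat_prod_list n Bs)"
      using Cons.prems(1) mat_prod_list_carrier[of Bs n] by auto
  qed
  then show ?case by simp
qed

lemma mat_prod_list_left_inverse:
  assumes f: "f ` set Bs \<subseteq> carrier_mat n n" and g: "g ` set Bs \<subseteq> carrier_mat n n"
    and inv: "\<And>B. B \<in> set Bs \<Longrightarrow> g B * f B = 1\<^sub>m n"
  shows "mat_prod_list n (map g (rev Bs)) * mat_prod_list n (map f Bs) = 1\<^sub>m n"
  using assms
proof (induction Bs)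
  case (Cons B Bs)
  let ?G = "mat_prod_list n (map g (rev Bs))" and ?F = "mat_prod_list n (map f Bs)"
  have car: "?G \<in> carrier_mat n n" "?F \<in> carrier_mat n n" "g B \<in> carrier_mat n n" "f B \<in> carrier_mat n n"
    using Cons.prems by (auto intro!: mat_prod_list_carrier)
  have "mat_prod_list n (map g (rev (B # Bs))) = ?G * g B"
    using Cons.prems(2) car by (simp add: mat_prod_list_append image_subset_iff)
  then have "mat_prod_list n (map g (rev (B # Bs))) * mat_prod_list n (map f (B # Bs))
      = ?G * (g B * (f B * ?F))"
    using car by (simp add: assoc_mult_mat[of _ n n _ n _ n])
  also have "g B * (f B * ?F) = (g B * f B) * ?F"
    using car by (intro assoc_mult_mat[symmetric]) auto
  also have "\<dots> = ?F" using Cons.prems(3)[of B] car by simp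
  finally show ?case using Cons by simp
qed simp

section \<open>Inverses\<close>

lemma mat_inv_eqI:
  assumes A: "A \<in> carrier_mat n n" and B: "B \<in> carrier_mat n n" and AB: "B * A = 1\<^sub>m n"
  shows "mat_inv A = B"
proof -
  have AB': "A * B = 1\<^sub>m n" by (rule mat_mult_left_right_inverse[OF B A AB])
  then have "A \<in> Units (ring_mat TYPE(real) n ())"
    using A B AB by (auto simp: Units_def ring_mat_simps)
  then obtain C where C: "mat_inverse A = Some C"
    using mat_inverse(1)[OF A, of "()"] by fastforce
  then have "A * C = 1\<^sub>m n" "C \<in> carrier_mat n n" using mat_inverse(2)[OF A] by auto
  then have "C = (B * A) * C" "B * (A * C) = B" using AB B by auto
  moreover have "(B * A) * C = B * (A * C)" using A B \<open>C \<in> carrier_mat n n\<close> by simp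
  ultimately show ?thesis using C by (simp add: mat_inv_def)
qed

text \<open>Solving for the unit vectors produces the columns of a right inverse.\<close>

lemma mat_inv_of_solver:
  assumes B: "B \<in> carrier_mat n n"
    and dim: "\<And>x. x \<in> carrier_vec n \<Longrightarrow> f x \<in> carrier_vec n"
    and solve: "\<And>x. x \<in> carrier_vec n \<Longrightarrow> B *\<^sub>v f x = x"
  shows "mat_inv B \<in> carrier_mat n n" and "mat_inv B * B = 1\<^sub>m n"
    and "\<And>x. x \<in> carrier_vec n \<Longrightarrow> mat_inv B *\<^sub>v x = f x"
proof -
  define X where "X = mat n n (\<lambda>(i, j). f (unit_vec n j) $ i)"
  have X: "X \<in> carrier_mat n n" by (simp add: X_def)
  have col: "col X j = f (unit_vec n j)" if "j < n" for j
    using dim[of "unit_vec n j"] that by (intro eq_vecI) (auto simp: X_def)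
  have "B * X = 1\<^sub>m n"
  proof (rule eq_matI)
    fix i j assume ij: "i < dim_row (1\<^sub>m n :: real mat)" "j < dim_col (1\<^sub>m n :: real mat)"
    then have "(B * X) $$ (i, j) = (B *\<^sub>v f (unit_vec n j)) $ i"
      using B X col[of j] by simp
    then show "(B * X) $$ (i, j) = 1\<^sub>m n $$ (i, j)"
      using ij solve[of "unit_vec n j"] by (auto simp: unit_vec_def)
  qed (use B X in auto)
  then have XB: "X * B = 1\<^sub>m n" by (rule mat_mult_left_right_inverse[OF B X])
  then have inv: "mat_inv B = X" by (rule mat_inv_eqI[OF B X])
  show "mat_inv B \<in> carrier_mat n n" "mat_inv B * B = 1\<^sub>m n" using inv X XB by auto
  show "mat_inv B *\<^sub>v x = f x" if x: "x \<in> carrier_vec n" for x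
  proof -
    have "mat_inv B *\<^sub>v x = X *\<^sub>v (B *\<^sub>v f x)" using inv solve[OF x] by simp
    also have "\<dots> = (X * B) *\<^sub>v f x" using X B dim[OF x] by simp
    finally show ?thesis using XB dim[OF x] by simp
  qed
qed

lemma nonneg_mat_inv_of_solver:
  assumes B: "B \<in> carrier_mat n n"
    and dim: "\<And>x. x \<in> carrier_vec n \<Longrightarrow> f x \<in> carrier_vec n"
    and solve: "\<And>x. x \<in> carrier_vec n \<Longrightarrow> B *\<^sub>v f x = x"
    and nonneg: "\<And>x i. x \<in> carrier_vec n \<Longrightarrow> \<forall>i<n. 0 \<le> x $ i \<Longrightarrow> i < n \<Longrightarrow> 0 \<le> f x $ i"
  shows "nonneg_mat (mat_inv B)"
  unfolding nonneg_mat_def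
proof (intro allI impI)
  note inv = mat_inv_of_solver[OF B dim solve]
  fix i j assume ij: "i < dim_row (mat_inv B)" "j < dim_col (mat_inv B)"
  then have lt: "i < n" "j < n" using inv(1) by auto
  have "mat_inv B $$ (i, j) = (mat_inv B *\<^sub>v unit_vec n j) $ i"
    using inv(1) lt by (simp add: mult_mat_vec_def)
  also have "\<dots> = f (unit_vec n j) $ i" using inv(3)[of "unit_vec n j"] by simp
  finally show "0 \<le> mat_inv B $$ (i, j)"
    using nonneg[of "unit_vec n j" i] lt by (auto simp: unit_vec_def)
qed

section \<open>The checkerboard sign change\<close>

text \<open>This is conjugation by the diagonal matrix with alternating entries \<open>1\<close> and \<open>-1\<close>.\<close>

definition checkerboard :: "real mat \<Rightarrow> real mat" where
  "checkerboard A = mat (dim_row A) (dim_col A) (\<lambda>(i, j). (-1) ^ (i + j) * A $$ (i, j))"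

lemma checkerboard_carrier [simp]: "checkerboard A \<in> carrier_mat m n \<longleftrightarrow> A \<in> carrier_mat m n"
  unfolding carrier_mat_def by (simp add: checkerboard_def)

lemma minus_one_power_merge: "(-1) ^ (i + k) * (-1) ^ (k + j) = ((-1) ^ (i + j) :: real)"
proof -
  have "(-1) ^ (i + k) * (-1) ^ (k + j) = ((-1) ^ (i + j) * ((-1) ^ k * (-1) ^ k) :: real)"
    by (simp only: power_add mult_ac)
  then show ?thesis by (cases "even k") simp_all
qed

lemma checkerboard_mult:
  assumes A: "A \<in> carrier_mat m n" and B: "B \<in> carrier_mat n p"
  shows "checkerboard (A * B) = checkerboard A * checkerboard B"
proof (rule eq_matI)
  fix i j assume "i < dim_row (checkerboard A * checkerboard B)"
    "j < dim_col (checkerboard A * checkerboard B)"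
  then have ij: "i < m" "j < p" using A B by (auto simp: checkerboard_def)
  have "(checkerboard A * checkerboard B) $$ (i, j) =
      (\<Sum>k<n. ((-1) ^ (i + k) * (-1) ^ (k + j)) * (A $$ (i, k) * B $$ (k, j)))"
    using A B ij
    by (auto simp: checkerboard_def scalar_prod_def atLeast0LessThan mult_ac intro!: sum.cong)
  also have "\<dots> = checkerboard (A * B) $$ (i, j)"
    using A B ij
    by (auto simp: minus_one_power_merge checkerboard_def scalar_prod_def atLeast0LessThan
        sum_distrib_left intro!: sum.cong)
  finally show "checkerboard (A * B) $$ (i, j) = (checkerboard A * checkerboard B) $$ (i, j)" ..
qed (use A B in \<open>auto simp: checkerboard_def\<close>)

lemma checkerboard_one: "checkerboard (1\<^sub>m n) = 1\<^sub>m n"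
  by (intro eq_matI) (auto simp: checkerboard_def)

lemma checkerboard_involution: "checkerboard (checkerboard A) = A"
proof -
  have "(-1) ^ k * ((-1) ^ k * a) = (a :: real)" for k :: nat and a
    by (cases "even k") simp_all
  then show ?thesis by (intro eq_matI) (auto simp: checkerboard_def)
qed

lemma checkerboard_mat_prod_list:
  "set Bs \<subseteq> carrier_mat n n \<Longrightarrow>
    checkerboard (mat_prod_list n Bs) = mat_prod_list n (map checkerboard Bs)"
proof (induction Bs)
  case (Cons B Bs)
  then have "B \<in> carrier_mat n n" "mat_prod_list n Bs \<in> carrier_mat n n"
    by (auto intro!: mat_prod_list_carrier)
  then show ?case using Cons by (simp add: checkerboard_mult)
qed (simp add: checkerboard_one)

text \<open>
  Within the tridiagonal band, \<open>i + j\<close> is odd exactly off the diagonal, where the comparison matrix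
  negates a nonnegative entry.
\<close>

lemma comparison_mat_eq_checkerboard:
  assumes A: "A \<in> carrier_mat n n" "nonneg_mat A"
    and tri: "\<And>i j. i < n \<Longrightarrow> j < n \<Longrightarrow> A $$ (i, j) \<noteq> 0 \<Longrightarrow> i = j \<or> i = Suc j \<or> j = Suc i"
  shows "comparison_mat A = checkerboard A"
proof (rule eq_matI)
  fix i j assume "i < dim_row (checkerboard A)" "j < dim_col (checkerboard A)"
  then have ij: "i < n" "j < n" using A by (auto simp: checkerboard_def)
  have "0 \<le> A $$ (i, j)" using A ij by (auto simp: nonneg_mat_def)
  then show "comparison_mat A $$ (i, j) = checkerboard A $$ (i, j)"
    using A(1) ij tri[OF ij] by (cases "A $$ (i, j) = 0")
      (auto simp: comparison_mat_def checkerboard_def)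
qed (auto simp: comparison_mat_def checkerboard_def)

text \<open>
  Conjugation turns each factor into its comparison matrix, hence the inverse of the product into
  the product \<open>P\<close> of the inverse comparison matrices. No cancellation occurs in \<open>P\<close>, because these are
  nonnegative, and signs do not affect absolute values.
\<close>

lemma abs_inverse_of_product:
  assumes Bs: "set Bs \<subseteq> carrier_mat n n"
    and comp: "\<And>B. B \<in> set Bs \<Longrightarrow> comparison_mat B = checkerboard B"
    and inv: "\<And>B. B \<in> set Bs \<Longrightarrow> mat_inv (comparison_mat B) \<in> carrier_mat n n \<and>
       mat_inv (comparison_mat B) * comparison_mat B = 1\<^sub>m n \<and> nonneg_mat (mat_inv (comparison_mat B))"
  defines "A \<equiv> mat_prod_list n Bs"
    and "P \<equiv> mat_prod_list n (map (\<lambda>B. mat_inv (comparison_mat B)) (rev Bs))"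
  shows "mat_inv A \<in> carrier_mat n n"
    and "i < n \<Longrightarrow> j < n \<Longrightarrow> \<bar>mat_inv A $$ (i, j)\<bar> = P $$ (i, j)"
proof -
  have A: "A \<in> carrier_mat n n" unfolding A_def by (rule mat_prod_list_carrier) fact
  have P: "P \<in> carrier_mat n n" unfolding P_def using inv by (intro mat_prod_list_carrier) auto
  have "nonneg_mat P" unfolding P_def using inv by (intro nonneg_mat_prod_list) auto
  then have P0: "0 \<le> P $$ (i, j)" if "i < n" "j < n" for i j
    using P that by (auto simp: nonneg_mat_def)
  have "P * mat_prod_list n (map comparison_mat Bs) = 1\<^sub>m n"
    unfolding P_def using inv Bs comp
    by (intro mat_prod_list_left_inverse) (auto simp: image_subset_iff subset_iff)
  also have "map comparison_mat Bs = map checkerboard Bs" using comp by simp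
  also have "mat_prod_list n (map checkerboard Bs) = checkerboard A"
    unfolding A_def by (rule checkerboard_mat_prod_list[OF Bs, symmetric])
  finally have "checkerboard (P * checkerboard A) = 1\<^sub>m n" by (simp add: checkerboard_one)
  then have "checkerboard P * A = 1\<^sub>m n"
    using P A by (simp add: checkerboard_mult[of _ n n _ n] checkerboard_involution)
  then have inv_A: "mat_inv A = checkerboard P" using A P by (intro mat_inv_eqI) auto
  show "mat_inv A \<in> carrier_mat n n" using inv_A P by simp
  show "\<bar>mat_inv A $$ (i, j)\<bar> = P $$ (i, j)" if "i < n" "j < n"
    using P P0[OF that] that by (simp add: inv_A checkerboard_def abs_mult power_abs)
qed

section \<open>Bidiagonal factors and their comparison matrices\<close>

lemma dim_comparison_mat [simp]:
  "dim_row (comparison_mat B) = dim_row B" "dim_col (comparison_mat B) = dim_col B"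
  by (simp_all add: comparison_mat_def)

lemma lower_comparison_mat:
  assumes B: "B \<in> carrier_mat n n" "lower_bidiagonal B" "unit_diagonal B"
    and off: "\<forall>k\<in>{1..<n}. 0 \<le> B $$ (k, k - 1)"
  shows "nonneg_mat B" and "comparison_mat B = checkerboard B"
    and "comparison_mat B \<in> carrier_mat n n" "lower_bidiagonal (comparison_mat B)"
      "unit_diagonal (comparison_mat B)"
    and "\<And>k. k \<in> {1..<n} \<Longrightarrow> comparison_mat B $$ (k, k - 1) = - B $$ (k, k - 1)"
proof -
  have nz: "j = i \<or> i = Suc j" if "i < n" "j < n" "B $$ (i, j) \<noteq> 0" for i j
    using B that by (auto simp: lower_bidiagonal_def upper_bidiagonal_def)
  have diag: "B $$ (i, i) = 1" if "i < n" for i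
    using B that by (auto simp: unit_diagonal_def)
  have "0 \<le> B $$ (i, j)" if "i < n" "j < n" for i j
    using nz[OF that] diag[of i] bspec[OF off, of i] that by (cases "B $$ (i, j) = 0") auto
  then show nn: "nonneg_mat B" using B(1) by (simp add: nonneg_mat_def)
  show "comparison_mat B = checkerboard B"
    using nz by (intro comparison_mat_eq_checkerboard[OF B(1) nn]) blast
  show "comparison_mat B \<in> carrier_mat n n" using B(1) by (intro carrier_matI) auto
  show "lower_bidiagonal (comparison_mat B)"
    using B(1) nz by (auto simp: lower_bidiagonal_def upper_bidiagonal_def comparison_mat_def)
  show "unit_diagonal (comparison_mat B)"
    using B(1) diag by (auto simp: unit_diagonal_def comparison_mat_def)
  show "comparison_mat B $$ (k, k - 1) = - B $$ (k, k - 1)" if "k \<in> {1..<n}" for k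
    using B(1) bspec[OF off that] that by (auto simp: comparison_mat_def)
qed

lemma upper_comparison_mat:
  assumes B: "B \<in> carrier_mat n n" "upper_bidiagonal B" "unit_diagonal B"
    and off: "\<forall>k\<in>{1..<n}. 0 \<le> B $$ (k - 1, k)"
  shows "nonneg_mat B" and "comparison_mat B = checkerboard B"
    and "comparison_mat B \<in> carrier_mat n n" "upper_bidiagonal (comparison_mat B)"
      "unit_diagonal (comparison_mat B)"
    and "\<And>k. k \<in> {1..<n} \<Longrightarrow> comparison_mat B $$ (k - 1, k) = - B $$ (k - 1, k)"
proof -
  have nz: "j = i \<or> j = Suc i" if "i < n" "j < n" "B $$ (i, j) \<noteq> 0" for i j
    using B that by (auto simp: upper_bidiagonal_def)
  have diag: "B $$ (i, i) = 1" if "i < n" for i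
    using B that by (auto simp: unit_diagonal_def)
  have "0 \<le> B $$ (i, j)" if "i < n" "j < n" for i j
    using nz[OF that] diag[of i] bspec[OF off, of j] that by (cases "B $$ (i, j) = 0") auto
  then show nn: "nonneg_mat B" using B(1) by (simp add: nonneg_mat_def)
  show "comparison_mat B = checkerboard B"
    using nz by (intro comparison_mat_eq_checkerboard[OF B(1) nn]) blast
  show "comparison_mat B \<in> carrier_mat n n" using B(1) by (intro carrier_matI) auto
  show "upper_bidiagonal (comparison_mat B)"
    using B(1) nz by (auto simp: upper_bidiagonal_def comparison_mat_def)
  show "unit_diagonal (comparison_mat B)"
    using B(1) diag by (auto simp: unit_diagonal_def comparison_mat_def)
  show "comparison_mat B $$ (k - 1, k) = - B $$ (k - 1, k)" if "k \<in> {1..<n}" for k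
    using B(1) bspec[OF off that] that by (auto simp: comparison_mat_def)
qed

lemma diagonal_comparison_mat:
  assumes D: "D \<in> carrier_mat n n" "diagonal_mat D" and pos: "\<forall>k<n. 0 < D $$ (k, k)"
  shows "nonneg_mat D" and "comparison_mat D = checkerboard D" and "comparison_mat D = D"
proof -
  have off: "D $$ (i, j) = 0" if "i < n" "j < n" "i \<noteq> j" for i j
    using D that by (auto simp: diagonal_mat_def)
  have "0 \<le> D $$ (i, j)" if "i < n" "j < n" for i j
    using off[OF that] pos that by (cases "i = j") (auto simp: less_imp_le)
  then show nn: "nonneg_mat D" using D(1) by (simp add: nonneg_mat_def)
  show "comparison_mat D = checkerboard D"
    using off by (intro comparison_mat_eq_checkerboard[OF D(1) nn]) blast
  show "comparison_mat D = D"
  proof (rule eq_matI)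
    fix i j assume "i < dim_row D" "j < dim_col D"
    then show "comparison_mat D $$ (i, j) = D $$ (i, j)"
      using D(1) off[of i j] pos by (cases "i = j") (auto simp: comparison_mat_def)
  qed simp_all
qed

text \<open>
  Nonnegativity of substitution is the case \<open>u = 0\<close> of the rounding analysis, which carries
  nonnegativity of the exact quantities along.
\<close>

lemma inverse_of_lower:
  assumes M: "M \<in> carrier_mat n n" "lower_bidiagonal M" "unit_diagonal M"
    and off: "\<forall>k\<in>{1..<n}. M $$ (k, k - 1) \<le> 0"
  shows "mat_inv M \<in> carrier_mat n n" "mat_inv M * M = 1\<^sub>m n" "nonneg_mat (mat_inv M)"
    and "\<And>x. x \<in> carrier_vec n \<Longrightarrow> mat_inv M *\<^sub>v x = lower_sweep exact Sub M [1..<n] x"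
proof -
  let ?f = "lower_sweep exact Sub M [1..<n]"
  have dim: "?f x \<in> carrier_vec n" if "x \<in> carrier_vec n" for x
    using that by (intro carrier_vecI) simp
  note solve = lower_sweep_solve[OF M]
  show "mat_inv M \<in> carrier_mat n n" "mat_inv M * M = 1\<^sub>m n"
    "\<And>x. x \<in> carrier_vec n \<Longrightarrow> mat_inv M *\<^sub>v x = ?f x"
    using mat_inv_of_solver[OF M(1) dim solve] by blast+
  show "nonneg_mat (mat_inv M)"
  proof (rule nonneg_mat_inv_of_solver[OF M(1) dim solve])
    fix x :: "real vec" and i assume "x \<in> carrier_vec n" "\<forall>i<n. 0 \<le> x $ i" and i: "i < n"
    then have "vec_close n UNIV 0 0 x x" by (simp add: vec_close_exact)
    then have "vec_close n UNIV 0 (0 + length [1..<n] * 2) (?f x) (?f x)"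
      using off by (intro vec_close_lower_sweep[OF standard_model_exact]) auto
    then show "0 \<le> ?f x $ i" using i by (simp add: vec_close_exact)
  qed
qed

lemma inverse_of_upper:
  assumes M: "M \<in> carrier_mat n n" "upper_bidiagonal M" "unit_diagonal M"
    and off: "\<forall>k\<in>{1..<n}. M $$ (k - 1, k) \<le> 0"
  shows "mat_inv M \<in> carrier_mat n n" "mat_inv M * M = 1\<^sub>m n" "nonneg_mat (mat_inv M)"
    and "\<And>x. x \<in> carrier_vec n \<Longrightarrow> mat_inv M *\<^sub>v x = upper_sweep exact Sub M (rev [1..<n]) x"
proof -
  let ?f = "upper_sweep exact Sub M (rev [1..<n])"
  have dim: "?f x \<in> carrier_vec n" if "x \<in> carrier_vec n" for x
    using that by (intro carrier_vecI) simp
  note solve = upper_sweep_solve[OF M]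
  show "mat_inv M \<in> carrier_mat n n" "mat_inv M * M = 1\<^sub>m n"
    "\<And>x. x \<in> carrier_vec n \<Longrightarrow> mat_inv M *\<^sub>v x = ?f x"
    using mat_inv_of_solver[OF M(1) dim solve] by blast+
  show "nonneg_mat (mat_inv M)"
  proof (rule nonneg_mat_inv_of_solver[OF M(1) dim solve])
    fix x :: "real vec" and i assume "x \<in> carrier_vec n" "\<forall>i<n. 0 \<le> x $ i" and i: "i < n"
    then have "vec_close n UNIV 0 0 x x" by (simp add: vec_close_exact)
    then have "vec_close n UNIV 0 (0 + length (rev [1..<n]) * 2) (?f x) (?f x)"
      using off by (intro vec_close_upper_sweep[OF standard_model_exact]) auto
    then show "0 \<le> ?f x $ i" using i by (simp add: vec_close_exact)
  qed
qed

lemma inverse_of_diagonal: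
  assumes D: "D \<in> carrier_mat n n" "diagonal_mat D" and pos: "\<forall>k<n. 0 < D $$ (k, k)"
  shows "mat_inv D \<in> carrier_mat n n" "mat_inv D * D = 1\<^sub>m n" "nonneg_mat (mat_inv D)"
    and "\<And>x. x \<in> carrier_vec n \<Longrightarrow>
           mat_inv D *\<^sub>v x = diagonal_sweep (\<lambda>d a. exact Div a d) D [0..<n] x"
proof -
  let ?f = "diagonal_sweep (\<lambda>d a. exact Div a d) D [0..<n]"
  have dim: "?f x \<in> carrier_vec n" if "x \<in> carrier_vec n" for x
    using that by (intro carrier_vecI) simp
  have nz: "D $$ (k, k) \<noteq> 0" if "k < n" for k using pos that by force
  note solve = diagonal_sweep_solve[OF D nz]
  show "mat_inv D \<in> carrier_mat n n" "mat_inv D * D = 1\<^sub>m n"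
    "\<And>x. x \<in> carrier_vec n \<Longrightarrow> mat_inv D *\<^sub>v x = ?f x"
    using mat_inv_of_solver[OF D(1) dim solve] by blast+
  show "nonneg_mat (mat_inv D)"
  proof (rule nonneg_mat_inv_of_solver[OF D(1) dim solve])
    fix x :: "real vec" and i assume "x \<in> carrier_vec n" "\<forall>i<n. 0 \<le> x $ i" "i < n"
    then show "0 \<le> ?f x $ i" using pos by (simp add: diagonal_sweep_index less_imp_le)
  qed
qed

section \<open>The factorization\<close>

lemma bidiagonal_factorsD:
  assumes "bidiagonal_factors n L D U"
  shows "D \<in> carrier_mat n n" "diagonal_mat D" "\<forall>k<n. 0 < D $$ (k, k)"
    and "\<And>i. i \<in> {1..<n} \<Longrightarrow> L i \<in> carrier_mat n n" "\<And>i. i \<in> {1..<n} \<Longrightarrow> lower_bidiagonal (L i)"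
      "\<And>i. i \<in> {1..<n} \<Longrightarrow> unit_diagonal (L i)"
      "\<And>i. i \<in> {1..<n} \<Longrightarrow> \<forall>k\<in>{1..<n}. 0 \<le> L i $$ (k, k - 1)"
    and "\<And>i. i \<in> {1..<n} \<Longrightarrow> U i \<in> carrier_mat n n" "\<And>i. i \<in> {1..<n} \<Longrightarrow> upper_bidiagonal (U i)"
      "\<And>i. i \<in> {1..<n} \<Longrightarrow> unit_diagonal (U i)"
      "\<And>i. i \<in> {1..<n} \<Longrightarrow> \<forall>k\<in>{1..<n}. 0 \<le> U i $$ (k - 1, k)"
proof -
  have sub: "0 \<le> B $$ (k, k - 1)"
    if "subdiagonal_pattern i B" "B \<in> carrier_mat n n" "k \<in> {1..<n}" for i k B
    using that unfolding subdiagonal_pattern_def by (metis carrier_matD(1) order_refl)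
  show "D \<in> carrier_mat n n" "diagonal_mat D" "\<forall>k<n. 0 < D $$ (k, k)"
    "\<And>i. i \<in> {1..<n} \<Longrightarrow> L i \<in> carrier_mat n n" "\<And>i. i \<in> {1..<n} \<Longrightarrow> lower_bidiagonal (L i)"
    "\<And>i. i \<in> {1..<n} \<Longrightarrow> unit_diagonal (L i)"
    "\<And>i. i \<in> {1..<n} \<Longrightarrow> U i \<in> carrier_mat n n" "\<And>i. i \<in> {1..<n} \<Longrightarrow> upper_bidiagonal (U i)"
    "\<And>i. i \<in> {1..<n} \<Longrightarrow> unit_diagonal (U i)"
    using assms unfolding bidiagonal_factors_def by blast+
  show "\<forall>k\<in>{1..<n}. 0 \<le> L i $$ (k, k - 1)" if "i \<in> {1..<n}" for i
    using assms that sub[of i "L i"] unfolding bidiagonal_factors_def by blast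
  show "\<forall>k\<in>{1..<n}. 0 \<le> U i $$ (k - 1, k)" if i: "i \<in> {1..<n}" for i
  proof
    fix k assume k: "k \<in> {1..<n}"
    have U: "U i \<in> carrier_mat n n" "subdiagonal_pattern i (transpose_mat (U i))"
      using assms i unfolding bidiagonal_factors_def by blast+
    have "0 \<le> transpose_mat (U i) $$ (k, k - 1)"
      using U by (intro sub[OF _ _ k]) auto
    then show "0 \<le> U i $$ (k - 1, k)" using U(1) k by auto
  qed
qed

definition product_sweeps ::
    "nat \<Rightarrow> (nat \<Rightarrow> real mat) \<Rightarrow> real mat \<Rightarrow> (nat \<Rightarrow> real mat) \<Rightarrow> real vec \<Rightarrow> real vec" where
  "product_sweeps n L D U x =
     fold (\<lambda>i. lower_sweep exact Add (L i) (rev [1..<n])) [1..<n]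
       (diagonal_sweep (exact Mul) D [0..<n]
         (fold (\<lambda>i. upper_sweep exact Add (U i) [1..<n]) (rev [1..<n]) x))"

definition inverse_sweeps ::
    "arith \<Rightarrow> nat \<Rightarrow> (nat \<Rightarrow> real mat) \<Rightarrow> real mat \<Rightarrow> (nat \<Rightarrow> real mat) \<Rightarrow> real vec \<Rightarrow> real vec" where
  "inverse_sweeps ar n L D U x =
     fold (\<lambda>i. upper_sweep ar Sub (comparison_mat (U i)) (rev [1..<n])) [1..<n]
       (diagonal_sweep (\<lambda>d a. ar Div a d) D [0..<n]
         (fold (\<lambda>i. lower_sweep ar Sub (comparison_mat (L i)) [1..<n]) (rev [1..<n]) x))"

definition sweep_flops :: "nat \<Rightarrow> nat" where
  "sweep_flops n = (n - 1) * (2 * (n - 1)) + (n + (n - 1) * (2 * (n - 1)))"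

lemma yields_eval_norm:
  assumes fac: "bidiagonal_factors n L D U"
  shows "yields (eval_norm exact n L D U) (sweep_flops n)
           (vec_norm_inf (product_sweeps n L D U (ones_vec n)))"
proof -
  note F = bidiagonal_factorsD[OF fac]
  have 1: "yields (for_each (rev [1..<n]) (\<lambda>i. mult_unit_upper exact (U i)) x)
      (length (rev [1..<n]) * (2 * (n - 1)))
      (fold (\<lambda>i. upper_sweep exact Add (U i) [1..<n]) (rev [1..<n]) x)" for x
    using F(8) by (intro yields_for_each yields_sweeps) auto
  have 2: "yields (mult_diagonal exact D x) n (diagonal_sweep (exact Mul) D [0..<n] x)" for x
    using F(1) by (intro yields_sweeps) auto
  have 3: "yields (for_each [1..<n] (\<lambda>i. mult_unit_lower exact (L i)) x)
      (length [1..<n] * (2 * (n - 1)))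
      (fold (\<lambda>i. lower_sweep exact Add (L i) (rev [1..<n])) [1..<n] x)" for x
    using F(4) by (intro yields_for_each yields_sweeps) auto
  have "yields (eval_norm exact n L D U)
      (length (rev [1..<n]) * (2 * (n - 1)) + (n + (length [1..<n] * (2 * (n - 1)) + 0)))
      (vec_norm_inf (product_sweeps n L D U (ones_vec n)))"
    unfolding eval_norm_def product_sweeps_def
    by (rule yields_bind[OF 1 yields_bind[OF 2 yields_bind[OF 3 yields_return]]])
  then show ?thesis by (simp add: sweep_flops_def)
qed

lemma yields_eval_inverse_norm:
  assumes fac: "bidiagonal_factors n L D U"
  shows "yields (eval_inverse_norm ar n L D U) (sweep_flops n)
           (vec_norm_inf (inverse_sweeps ar n L D U (ones_vec n)))"
proof -
  note F = bidiagonal_factorsD[OF fac]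
  have 1: "yields (for_each (rev [1..<n]) (\<lambda>i. solve_unit_lower ar (comparison_mat (L i))) x)
      (length (rev [1..<n]) * (2 * (n - 1)))
      (fold (\<lambda>i. lower_sweep ar Sub (comparison_mat (L i)) [1..<n]) (rev [1..<n]) x)" for x
    using F(4) by (intro yields_for_each yields_sweeps) auto
  have 2: "yields (solve_diagonal ar D x) n (diagonal_sweep (\<lambda>d a. ar Div a d) D [0..<n] x)" for x
    using F(1) by (intro yields_sweeps) auto
  have 3: "yields (for_each [1..<n] (\<lambda>i. solve_unit_upper ar (comparison_mat (U i))) x)
      (length [1..<n] * (2 * (n - 1)))
      (fold (\<lambda>i. upper_sweep ar Sub (comparison_mat (U i)) (rev [1..<n])) [1..<n] x)" for x
    using F(8) by (intro yields_for_each yields_sweeps) auto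
  have "yields (eval_inverse_norm ar n L D U)
      (length (rev [1..<n]) * (2 * (n - 1)) + (n + (length [1..<n] * (2 * (n - 1)) + 0)))
      (vec_norm_inf (inverse_sweeps ar n L D U (ones_vec n)))"
    unfolding eval_inverse_norm_def inverse_sweeps_def
    by (rule yields_bind[OF 1 yields_bind[OF 2 yields_bind[OF 3 yields_return]]])
  then show ?thesis by (simp add: sweep_flops_def)
qed

lemma fold_mult_vec_carrier:
  assumes "\<And>i. i \<in> set is \<Longrightarrow> B i \<in> carrier_mat n n" and "x \<in> carrier_vec n"
  shows "fold (\<lambda>i. (*\<^sub>v) (B i)) is x \<in> carrier_vec n"
  using assms
proof (induction "is" arbitrary: x)
  case (Cons i "is")
  have "B i *\<^sub>v x \<in> carrier_vec n"
    using Cons.prems by (intro mult_mat_vec_carrier[of _ n n]) auto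
  then show ?case using Cons by simp
qed simp

lemma fold_eq_mult_vec:
  assumes "\<And>i. i \<in> set is \<Longrightarrow> B i \<in> carrier_mat n n"
    and "\<And>i x. i \<in> set is \<Longrightarrow> x \<in> carrier_vec n \<Longrightarrow> f i x = B i *\<^sub>v x" and "x \<in> carrier_vec n"
  shows "fold f is x = fold (\<lambda>i. (*\<^sub>v) (B i)) is x"
  using assms
proof (induction "is" arbitrary: x)
  case (Cons i "is")
  have "B i *\<^sub>v x \<in> carrier_vec n"
    using Cons.prems by (intro mult_mat_vec_carrier[of _ n n]) auto
  then show ?case using Cons by simp
qed simp

lemma foldr_mult_vec_map:
  "foldr (*\<^sub>v) (map B (rev is)) x = fold (\<lambda>i. (*\<^sub>v) (B i)) is x"
  "foldr (*\<^sub>v) (map B is) x = fold (\<lambda>i. (*\<^sub>v) (B i)) (rev is) x"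
  by (simp_all add: foldr_conv_fold rev_map fold_map comp_def)

lemma product_sweeps_eq:
  assumes fac: "bidiagonal_factors n L D U" and x: "x \<in> carrier_vec n"
  shows "product_sweeps n L D U x =
    mat_prod_list n (map L (rev [1..<n]) @ [D] @ map U [1..<n]) *\<^sub>v x"
proof -
  note F = bidiagonal_factorsD[OF fac]
  define v where "v = fold (\<lambda>i. (*\<^sub>v) (U i)) (rev [1..<n]) x"
  have v: "fold (\<lambda>i. upper_sweep exact Add (U i) [1..<n]) (rev [1..<n]) x = v"
    unfolding v_def by (rule fold_eq_mult_vec[OF _ upper_sweep_mult x]) (use F(8-10) in auto)
  have v': "v \<in> carrier_vec n"
    unfolding v_def by (rule fold_mult_vec_carrier[OF _ x]) (use F(8) in auto)
  have w: "D *\<^sub>v v \<in> carrier_vec n" using F(1) v' by auto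
  have "fold (\<lambda>i. lower_sweep exact Add (L i) (rev [1..<n])) [1..<n] (D *\<^sub>v v)
      = fold (\<lambda>i. (*\<^sub>v) (L i)) [1..<n] (D *\<^sub>v v)"
    by (rule fold_eq_mult_vec[OF _ lower_sweep_mult w]) (use F(4-6) in auto)
  then have "product_sweeps n L D U x = fold (\<lambda>i. (*\<^sub>v) (L i)) [1..<n] (D *\<^sub>v v)"
    using diagonal_sweep_mult[OF F(1,2) v'] by (simp only: product_sweeps_def v)
  also have "\<dots> = foldr (*\<^sub>v) (map L (rev [1..<n]) @ [D] @ map U [1..<n]) x"
    by (simp add: foldr_mult_vec_map v_def)
  also have "\<dots> = mat_prod_list n (map L (rev [1..<n]) @ [D] @ map U [1..<n]) *\<^sub>v x"
    using F(1,4,8) x by (intro mat_prod_list_mult_vec[symmetric]) auto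
  finally show ?thesis .
qed

lemma
  assumes fac: "bidiagonal_factors n L D U" and i: "i \<in> {1..<n}"
  shows inverse_of_lower_factor:
      "mat_inv (comparison_mat (L i)) \<in> carrier_mat n n"
      "mat_inv (comparison_mat (L i)) * comparison_mat (L i) = 1\<^sub>m n"
      "nonneg_mat (mat_inv (comparison_mat (L i)))"
      "\<And>x. x \<in> carrier_vec n \<Longrightarrow> mat_inv (comparison_mat (L i)) *\<^sub>v x =
         lower_sweep exact Sub (comparison_mat (L i)) [1..<n] x"
    and inverse_of_upper_factor:
      "mat_inv (comparison_mat (U i)) \<in> carrier_mat n n"
      "mat_inv (comparison_mat (U i)) * comparison_mat (U i) = 1\<^sub>m n"
      "nonneg_mat (mat_inv (comparison_mat (U i)))"
      "\<And>x. x \<in> carrier_vec n \<Longrightarrow> mat_inv (comparison_mat (U i)) *\<^sub>v x =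
         upper_sweep exact Sub (comparison_mat (U i)) (rev [1..<n]) x"
proof -
  note F = bidiagonal_factorsD[OF fac]
  note L = lower_comparison_mat[OF F(4-7)[OF i]]
  note U = upper_comparison_mat[OF F(8-11)[OF i]]
  have "\<forall>k\<in>{1..<n}. comparison_mat (L i) $$ (k, k - 1) \<le> 0"
    using L(6) F(7)[OF i] by simp
  note inv = inverse_of_lower[OF L(3-5) this]
  show "mat_inv (comparison_mat (L i)) \<in> carrier_mat n n"
      "mat_inv (comparison_mat (L i)) * comparison_mat (L i) = 1\<^sub>m n"
      "nonneg_mat (mat_inv (comparison_mat (L i)))"
      "\<And>x. x \<in> carrier_vec n \<Longrightarrow> mat_inv (comparison_mat (L i)) *\<^sub>v x =
         lower_sweep exact Sub (comparison_mat (L i)) [1..<n] x"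
    by (fact inv)+
  have "\<forall>k\<in>{1..<n}. comparison_mat (U i) $$ (k - 1, k) \<le> 0"
    using U(6) F(11)[OF i] by simp
  note inv = inverse_of_upper[OF U(3-5) this]
  show "mat_inv (comparison_mat (U i)) \<in> carrier_mat n n"
      "mat_inv (comparison_mat (U i)) * comparison_mat (U i) = 1\<^sub>m n"
      "nonneg_mat (mat_inv (comparison_mat (U i)))"
      "\<And>x. x \<in> carrier_vec n \<Longrightarrow> mat_inv (comparison_mat (U i)) *\<^sub>v x =
         upper_sweep exact Sub (comparison_mat (U i)) (rev [1..<n]) x"
    by (fact inv)+
qed

lemma inverse_sweeps_eq:
  assumes fac: "bidiagonal_factors n L D U" and x: "x \<in> carrier_vec n"
  shows "inverse_sweeps exact n L D U x =
    mat_prod_list n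
      (map (\<lambda>i. mat_inv (comparison_mat (U i))) (rev [1..<n]) @ [mat_inv D] @
       map (\<lambda>i. mat_inv (comparison_mat (L i))) [1..<n]) *\<^sub>v x"
    (is "_ = mat_prod_list n (map ?U _ @ _ @ map ?L _) *\<^sub>v x")
proof -
  note F = bidiagonal_factorsD[OF fac]
  note Li = inverse_of_lower_factor[OF fac]
  note Ui = inverse_of_upper_factor[OF fac]
  note Di = inverse_of_diagonal[OF F(1-3)]
  define v where "v = fold (\<lambda>i. (*\<^sub>v) (?L i)) (rev [1..<n]) x"
  have v: "fold (\<lambda>i. lower_sweep exact Sub (comparison_mat (L i)) [1..<n]) (rev [1..<n]) x = v"
    unfolding v_def by (rule fold_eq_mult_vec[OF _ Li(4)[symmetric] x]) (use Li(1) in auto)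
  have v': "v \<in> carrier_vec n"
    unfolding v_def by (rule fold_mult_vec_carrier[OF _ x]) (use Li(1) in auto)
  have w: "mat_inv D *\<^sub>v v \<in> carrier_vec n" using Di(1) v' by auto
  have "inverse_sweeps exact n L D U x = fold (\<lambda>i. (*\<^sub>v) (?U i)) [1..<n] (mat_inv D *\<^sub>v v)"
    unfolding inverse_sweeps_def v Di(4)[OF v', symmetric]
    by (rule fold_eq_mult_vec[OF _ Ui(4)[symmetric] w]) (use Ui(1) in auto)
  also have "\<dots> = foldr (*\<^sub>v) (map ?U (rev [1..<n]) @ [mat_inv D] @ map ?L [1..<n]) x"
    by (simp add: foldr_mult_vec_map v_def)
  also have "\<dots> = mat_prod_list n (map ?U (rev [1..<n]) @ [mat_inv D] @ map ?L [1..<n]) *\<^sub>v x"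
    using Di(1) Li(1) Ui(1) x by (intro mat_prod_list_mult_vec[symmetric]) auto
  finally show ?thesis .
qed

lemma norm_of_product:
  assumes fac: "bidiagonal_factors n L D U" and n: "1 \<le> n"
  defines "A \<equiv> mat_prod_list n (map L (rev [1..<n]) @ [D] @ map U [1..<n])"
  shows "mat_norm_inf A = vec_norm_inf (A *\<^sub>v ones_vec n)"
proof -
  note F = bidiagonal_factorsD[OF fac]
  have Bs: "set (map L (rev [1..<n]) @ [D] @ map U [1..<n]) \<subseteq> carrier_mat n n"
    using F(1,4,8) by auto
  have A: "A \<in> carrier_mat n n" unfolding A_def by (rule mat_prod_list_carrier[OF Bs])
  have "nonneg_mat (L i)" if i: "i \<in> {1..<n}" for i
    by (rule lower_comparison_mat(1)[OF F(4-7)[OF i]])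
  moreover have "nonneg_mat (U i)" if i: "i \<in> {1..<n}" for i
    by (rule upper_comparison_mat(1)[OF F(8-11)[OF i]])
  ultimately have "nonneg_mat A"
    unfolding A_def using diagonal_comparison_mat(1)[OF F(1-3)]
    by (intro nonneg_mat_prod_list[OF Bs]) auto
  then show ?thesis
    using A n by (intro mat_norm_inf_of_abs[OF A A]) (auto simp: nonneg_mat_def)
qed

lemma norm_of_inverse:
  assumes fac: "bidiagonal_factors n L D U" and n: "1 \<le> n"
  shows "mat_norm_inf (mat_inv (mat_prod_list n (map L (rev [1..<n]) @ [D] @ map U [1..<n]))) =
    vec_norm_inf (mat_prod_list n
      (map (\<lambda>i. mat_inv (comparison_mat (U i))) (rev [1..<n]) @ [mat_inv D] @
       map (\<lambda>i. mat_inv (comparison_mat (L i))) [1..<n]) *\<^sub>v ones_vec n)"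
    (is "_ = vec_norm_inf (mat_prod_list n ?Ps *\<^sub>v _)")
proof -
  note F = bidiagonal_factorsD[OF fac]
  note D = diagonal_comparison_mat[OF F(1-3)]
  note Di = inverse_of_diagonal[OF F(1-3)]
  define Bs where "Bs = map L (rev [1..<n]) @ [D] @ map U [1..<n]"
  have Bs: "set Bs \<subseteq> carrier_mat n n" using F(1,4,8) by (auto simp: Bs_def)
  have cases: "P B" if "B \<in> set Bs" "\<And>i. i \<in> {1..<n} \<Longrightarrow> P (L i)" "P D"
    "\<And>i. i \<in> {1..<n} \<Longrightarrow> P (U i)" for P B
    using that by (auto simp: Bs_def)
  have comp: "comparison_mat B = checkerboard B" if "B \<in> set Bs" for B
  proof (rule cases[OF that])
    fix i assume i: "i \<in> {1..<n}"
    show "comparison_mat (L i) = checkerboard (L i)"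
      by (rule lower_comparison_mat(2)[OF F(4-7)[OF i]])
    show "comparison_mat (U i) = checkerboard (U i)"
      by (rule upper_comparison_mat(2)[OF F(8-11)[OF i]])
  qed (rule D(2))
  have inv: "mat_inv (comparison_mat B) \<in> carrier_mat n n \<and>
      mat_inv (comparison_mat B) * comparison_mat B = 1\<^sub>m n \<and>
      nonneg_mat (mat_inv (comparison_mat B))" if "B \<in> set Bs" for B
    by (rule cases[OF that])
      (use inverse_of_lower_factor[OF fac] inverse_of_upper_factor[OF fac] Di D(3) in auto)
  have Ps: "map (\<lambda>B. mat_inv (comparison_mat B)) (rev Bs) = ?Ps"
    by (simp add: Bs_def rev_map D(3))
  note abs = abs_inverse_of_product[OF Bs comp inv, unfolded Ps]
  have "mat_prod_list n ?Ps \<in> carrier_mat n n"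
    unfolding Ps[symmetric] using inv by (intro mat_prod_list_carrier) auto
  then show ?thesis
    unfolding Bs_def[symmetric] using n by (intro mat_norm_inf_of_abs[OF abs(1) _ _ abs(2)]) auto
qed

text \<open>
  A flop changes one entry only, but the exponent is raised for all of them. What this gives away is a
  constant factor: a relative error of order \<open>n\<^sup>2u\<close> is what is claimed.
\<close>

lemma vec_close_inverse_sweeps:
  assumes fac: "bidiagonal_factors n L D U" and fl: "standard_model F fl u" and u: "u \<le> 1"
    and D: "elements_mat D \<subseteq> F"
    and LU: "\<And>i. i \<in> {1..<n} \<Longrightarrow> elements_mat (L i) \<subseteq> F \<and> elements_mat (U i) \<subseteq> F"
  shows "vec_close n F u (sweep_flops n)
    (inverse_sweeps fl n L D U (ones_vec n)) (inverse_sweeps exact n L D U (ones_vec n))"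
proof -
  note B = bidiagonal_factorsD[OF fac]
  have neg: "- a \<in> F" if "a \<in> F" for a using fl that by (simp add: standard_model_def)
  have L: "comparison_mat (L i) $$ (k, k - 1) \<in> F \<and> comparison_mat (L i) $$ (k, k - 1) \<le> 0"
    if i: "i \<in> {1..<n}" and k: "k \<in> {1..<n}" for i k
  proof -
    have "L i $$ (k, k - 1) \<in> elements_mat (L i)"
      using B(4)[OF i] k by (intro elements_matI[of _ n n k "k - 1"]) auto
    then show ?thesis
      using lower_comparison_mat(6)[OF B(4-7)[OF i] k] bspec[OF B(7)[OF i] k] LU[OF i] neg by auto
  qed
  have U: "comparison_mat (U i) $$ (k - 1, k) \<in> F \<and> comparison_mat (U i) $$ (k - 1, k) \<le> 0"
    if i: "i \<in> {1..<n}" and k: "k \<in> {1..<n}" for i k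
  proof -
    have "U i $$ (k - 1, k) \<in> elements_mat (U i)"
      using B(8)[OF i] k by (intro elements_matI[of _ n n "k - 1" k]) auto
    then show ?thesis
      using upper_comparison_mat(6)[OF B(8-11)[OF i] k] bspec[OF B(11)[OF i] k] LU[OF i] neg by auto
  qed
  have D: "D $$ (k, k) \<in> F \<and> 0 < D $$ (k, k)" if "k < n" for k
    using D B(1) B(3) that elements_matI[of D n n k k] by auto
  let ?R = "vec_close n F u"
  define y where "y ar = fold (\<lambda>i. lower_sweep ar Sub (comparison_mat (L i)) [1..<n]) (rev [1..<n])
    (ones_vec n)" for ar
  define z where "z ar = diagonal_sweep (\<lambda>d a. ar Div a d) D [0..<n] (y ar)" for ar
  have "?R 0 (ones_vec n) (ones_vec n)"
    using fl by (auto simp: vec_close_def rel_close_def ones_vec_def standard_model_def)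
  then have y: "?R (0 + length (rev [1..<n]) * (length [1..<n] * 2)) (y fl) (y exact)"
    unfolding y_def
  proof (rule fold_accumulate[where R = ?R, rotated])
    fix i m x' x assume "i \<in> set (rev [1..<n])" and x: "?R m x' x"
    then have i: "i \<in> {1..<n}" by simp
    show "?R (m + length [1..<n] * 2) (lower_sweep fl Sub (comparison_mat (L i)) [1..<n] x')
        (lower_sweep exact Sub (comparison_mat (L i)) [1..<n] x)"
      using L[OF i] x by (intro vec_close_lower_sweep[OF fl u]) auto
  qed
  have z: "?R (0 + length (rev [1..<n]) * (length [1..<n] * 2) + length [0..<n] * 1)
      (z fl) (z exact)"
    unfolding z_def using D y by (intro vec_close_diagonal_sweep[OF fl u]) auto
  have "?R (0 + length (rev [1..<n]) * (length [1..<n] * 2) + length [0..<n] * 1 +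
        length [1..<n] * (length (rev [1..<n]) * 2))
      (inverse_sweeps fl n L D U (ones_vec n)) (inverse_sweeps exact n L D U (ones_vec n))"
    unfolding inverse_sweeps_def y_def[symmetric] z_def[symmetric]
  proof (rule fold_accumulate[where R = ?R, OF _ z])
    fix i m x' x assume "i \<in> set [1..<n]" and x: "?R m x' x"
    then have i: "i \<in> {1..<n}" by simp
    show "?R (m + length (rev [1..<n]) * 2)
        (upper_sweep fl Sub (comparison_mat (U i)) (rev [1..<n]) x')
        (upper_sweep exact Sub (comparison_mat (U i)) (rev [1..<n]) x)"
      using U[OF i] x by (intro vec_close_upper_sweep[OF fl u]) auto
  qed
  moreover have "0 + length (rev [1..<n]) * (length [1..<n] * 2) + length [0..<n] * 1 +
      length [1..<n] * (length (rev [1..<n]) * 2) = sweep_flops n"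
    by (simp add: sweep_flops_def)
  ultimately show ?thesis by (simp only:)
qed

lemma sweep_flops_le:
  assumes "1 \<le> n"
  shows "real (sweep_flops n) \<le> 4 * (real n)\<^sup>2" and "2 * real (sweep_flops n) + 1 \<le> 8 * (real n)\<^sup>2"
proof -
  have "real (sweep_flops n) = 4 * (real n - 1)\<^sup>2 + real n"
    using assms by (simp add: sweep_flops_def of_nat_diff power2_eq_square)
  then show "real (sweep_flops n) \<le> 4 * (real n)\<^sup>2" "2 * real (sweep_flops n) + 1 \<le> 8 * (real n)\<^sup>2"
    using assms by (simp_all add: power2_eq_square algebra_simps)
qed

theorem mainTheorem5:
  "\<exists>C c\<^sub>0 d :: real. 0 < C \<and> 0 < c\<^sub>0 \<and> 0 < d \<and>
     (\<forall>(n :: nat) (A :: real mat) (L :: nat \<Rightarrow> real mat) (D :: real mat) (U :: nat \<Rightarrow> real mat).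
        1 \<le> n \<longrightarrow> A \<in> carrier_mat n n \<longrightarrow> invertible_mat A \<longrightarrow> totally_nonnegative A \<longrightarrow>
        bidiagonal_factors n L D U \<longrightarrow>
        A = mat_prod_list n (map L (rev [1..<n]) @ [D] @ map U [1..<n]) \<longrightarrow>
          mat_norm_inf A =
            vec_norm_inf
              (mat_prod_list n (map L (rev [1..<n]) @ [D] @ map U [1..<n]) *\<^sub>v ones_vec n) \<and>
          mat_norm_inf (mat_inv A) =
            vec_norm_inf
              (mat_prod_list n
                 (map (\<lambda>i. mat_inv (comparison_mat (U i))) (rev [1..<n]) @
                  [mat_inv D] @
                  map (\<lambda>i. mat_inv (comparison_mat (L i))) [1..<n]) *\<^sub>v ones_vec n) \<and>
          result (eval_norm exact n L D U) = mat_norm_inf A \<and>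
          result (eval_inverse_norm exact n L D U) = mat_norm_inf (mat_inv A) \<and>
          result (eval_cond exact n L D U) = cond_inf A \<and>
          real (flop_count (eval_cond exact n L D U)) \<le> C * (real n)\<^sup>2 \<and>
          (\<forall>(F :: real set) (fl :: arith) (u :: real).
             standard_model F fl u \<longrightarrow>
             elements_mat D \<subseteq> F \<longrightarrow>
             (\<forall>i\<in>{1..<n}. elements_mat (L i) \<subseteq> F \<and> elements_mat (U i) \<subseteq> F) \<longrightarrow>
             (real n)\<^sup>2 * u \<le> c\<^sub>0 \<longrightarrow>
               \<bar>result (eval_inverse_norm fl n L D U) - mat_norm_inf (mat_inv A)\<bar> /
                 mat_norm_inf (mat_inv A) \<le> d * (real n)\<^sup>2 * u))"
  \<comment> \<open>Each norm takes \<open>4(n - 1)\<^sup>2 + n \<le> 4n\<^sup>2\<close> flops; two of them and one product fit into \<open>8n\<^sup>2\<close>. With \<open>c\<^sub>0 = 1/4\<close>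
    the product of \<open>4n\<^sup>2\<close> and \<open>u\<close> is at most \<open>1\<close>, so that linearising the powers costs a factor \<open>2\<close>,
    whence \<open>d = 8\<close>.\<close>
proof (rule exI[of _ 8], rule exI[of _ "1 / 4"], rule exI[of _ 8], intro conjI allI impI)
  fix n :: nat and A :: "real mat" and L U :: "nat \<Rightarrow> real mat" and D :: "real mat"
  assume n: "1 \<le> n" and fac: "bidiagonal_factors n L D U"
    and A: "A = mat_prod_list n (map L (rev [1..<n]) @ [D] @ map U [1..<n])"
  let ?A = "mat_prod_list n (map L (rev [1..<n]) @ [D] @ map U [1..<n])"
  let ?P = "mat_prod_list n
    (map (\<lambda>i. mat_inv (comparison_mat (U i))) (rev [1..<n]) @ [mat_inv D] @
     map (\<lambda>i. mat_inv (comparison_mat (L i))) [1..<n])"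
  have ones: "ones_vec n \<in> carrier_vec n" by (simp add: ones_vec_def)
  show norm_A: "mat_norm_inf A = vec_norm_inf (?A *\<^sub>v ones_vec n)"
    unfolding A by (rule norm_of_product[OF fac n])
  show norm_inv: "mat_norm_inf (mat_inv A) = vec_norm_inf (?P *\<^sub>v ones_vec n)"
    unfolding A by (rule norm_of_inverse[OF fac n])
  have a: "yields (eval_norm exact n L D U) (sweep_flops n) (mat_norm_inf A)"
    using yields_eval_norm[OF fac] by (simp only: norm_A product_sweeps_eq[OF fac ones])
  have c: "yields (eval_inverse_norm exact n L D U) (sweep_flops n) (mat_norm_inf (mat_inv A))"
    using yields_eval_inverse_norm[OF fac, of exact]
    by (simp only: norm_inv inverse_sweeps_eq[OF fac ones])
  show "result (eval_norm exact n L D U) = mat_norm_inf A"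
    by (rule result_yields[OF a])
  show "result (eval_inverse_norm exact n L D U) = mat_norm_inf (mat_inv A)"
    by (rule result_yields[OF c])
  have cond: "yields (eval_cond exact n L D U) (sweep_flops n + (sweep_flops n + 1)) (cond_inf A)"
    using yields_bind[OF a yields_bind[OF c yields_flop[of exact Mul]]]
    by (simp add: eval_cond_def cond_inf_def)
  show "result (eval_cond exact n L D U) = cond_inf A"
    using cond by (rule result_yields)
  show "real (flop_count (eval_cond exact n L D U)) \<le> 8 * (real n)\<^sup>2"
    using flop_count_yields[OF cond] sweep_flops_le(2)[OF n] by simp
  fix F :: "real set" and fl :: arith and u :: real
  assume fl: "standard_model F fl u" and D: "elements_mat D \<subseteq> F"
    and LU: "\<forall>i\<in>{1..<n}. elements_mat (L i) \<subseteq> F \<and> elements_mat (U i) \<subseteq> F"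
    and nu: "(real n)\<^sup>2 * u \<le> 1 / 4"
  have u0: "0 \<le> u" by (rule standard_model_nonneg) fact
  have "1 * u \<le> (real n)\<^sup>2 * u" using n u0 by (intro mult_right_mono) auto
  then have u1: "u \<le> 1" using nu by simp
  let ?c = "mat_norm_inf (mat_inv A)" and ?c' = "result (eval_inverse_norm fl n L D U)"
  have "?c' = vec_norm_inf (inverse_sweeps fl n L D U (ones_vec n))"
    by (rule result_yields[OF yields_eval_inverse_norm[OF fac]])
  moreover have "?c = vec_norm_inf (inverse_sweeps exact n L D U (ones_vec n))"
    using norm_inv by (simp only: inverse_sweeps_eq[OF fac ones])
  moreover have "vec_close n F u (sweep_flops n)
      (inverse_sweeps fl n L D U (ones_vec n)) (inverse_sweeps exact n L D U (ones_vec n))"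
    using LU by (intro vec_close_inverse_sweeps[OF fac fl u1 D]) blast
  ultimately have close: "rel_close u (sweep_flops n) ?c' ?c"
    using vec_close_norm[OF _ _ u0 u1] n by simp
  have Nu: "real (sweep_flops n) * u \<le> 4 * ((real n)\<^sup>2 * u)"
    using mult_right_mono[OF sweep_flops_le(1)[OF n] u0] by simp
  have c0: "0 \<le> ?c" using close by (simp add: rel_close_def)
  have "\<bar>?c' - ?c\<bar> \<le> 2 * (real (sweep_flops n) * u) * ?c"
    using Nu nu by (intro rel_close_abs_error[OF close u0 u1]) simp
  also have "\<dots> \<le> (8 * (real n)\<^sup>2 * u) * ?c"
  proof (rule mult_right_mono[OF _ c0])
    have "2 * (real (sweep_flops n) * u) \<le> 2 * (4 * ((real n)\<^sup>2 * u))"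
      by (rule mult_left_mono[OF Nu]) simp
    also have "\<dots> = 8 * (real n)\<^sup>2 * u" by simp
    finally show "2 * (real (sweep_flops n) * u) \<le> 8 * (real n)\<^sup>2 * u" .
  qed
  finally have bound: "\<bar>?c' - ?c\<bar> \<le> (8 * (real n)\<^sup>2 * u) * ?c" .
  show "\<bar>?c' - ?c\<bar> / ?c \<le> 8 * (real n)\<^sup>2 * u"
  \<comment> \<open>If the norm were zero, the quotient would be zero by the convention for division.\<close>
  proof (cases "?c = 0")
    case True
    then show ?thesis using u0 by simp
  next
    case False
    with c0 have "0 < ?c" by simp
    with bound show ?thesis by (simp add: divide_le_eq)
  qed
qed simp_all

end
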